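(* Consider the noise-intervened Hegselmann–Krause system described in the context, with $n$ agents, confidence threshold $\epsilon>0$, divisive initial state with cluster values $x_1^*<\dots<x_{N_c}^*$, and noise uniformly distributed on $[-\delta_1,\delta_2]$ with $0\le\delta_1\le\delta_2$ and $0<\delta_2\le\frac{\epsilon}{2n}$. Let $T=\inf\{t\ge0: d_{\mathcal V}(t)\le\epsilon\}$. Then: 1. if $\delta_1=\delta_2$, then $\mathbf E\,T=\infty$; 2. if $\delta_1<\delta_2$, then $\mathbf E\,T\le\frac{2n}{\delta_2-\delta_1}\bigl(x_{N_c}^*-x_1^*+(N_c-1)\delta_2\bigr)$.
   Context: Time $t\in\{0,1,2,\dots\}$ is discrete. Agents are $\mathcal V=\{1,\dots,n\}$, with opinions $x(t)=(x_1(t),\dots,x_n(t))\in\mathbb R^n$. The confidence threshold is $\epsilon>0$, and the neighbor set of agent $i$ is $\mathcal N_i(x(t))=\{j\in\mathcal V: |x_j(t)-x_i(t)|\le\epsilon\}$. Divisive initial state: $\mathcal V$ is partitioned into nonempty disjoint clusters $\mathcal V_1,\dots,\mathcal V_{N_c}$ with $2\le N_c\le n$; there are real numbers $x_1^*,\dots,x_{N_c}^*$ with $x_p^*-x_q^*>\epsilon$ for all $1\le q<p\le N_c$; and $x_i(0)=x_g^*$ for every $i\in\mathcal V_g$, $1\le g\le N_c$. Agent $1$ belongs to $\mathcal V_1$ (the cluster with the smallest opinion value). Dynamics: for all $i\in\mathcal V$ and $t\ge0$, $$x_i(t+1)=\frac{1}{|\mathcal N_i(x(t))|}\sum_{j\in\mathcal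 N_i(x(t))}x_j(t)+I_{\{i=1\}}\,\xi(t+1),$$ where $I_{\{i=1\}}$ equals $1$ if $i=1$ and $0$ otherwise, and $\{\xi(t),t\ge1\}$ are independent random variables, each uniformly distributed on $[-\delta_1,\delta_2]$, with $0\le\delta_1\le\delta_2$. Notation: $d_{\mathcal V}(t)=\max_{i,j\in\mathcal V}|x_i(t)-x_j(t)|$; $\mathbf E$ denotes expectation. *)

theory Defs
  imports "HOL-Probability.Probability"
begin

text \<open>
  Agents are the natural numbers \<open>1, \<dots>, n\<close>; an opinion profile is a function
  \<open>y :: nat \<Rightarrow> real\<close> of which only the values on \<open>{1..n}\<close> matter.
\<close>

definition hk_neighbors :: "nat \<Rightarrow> real \<Rightarrow> (nat \<Rightarrow> real) \<Rightarrow> nat \<Rightarrow> nat set" where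
  "hk_neighbors n \<epsilon> y i = {j \<in> {1..n}. \<bar>y j - y i\<bar> \<le> \<epsilon>}"

definition opinion_diameter :: "nat \<Rightarrow> (nat \<Rightarrow> real) \<Rightarrow> real" where
  "opinion_diameter n y = Max ((\<lambda>(i, j). \<bar>y i - y j\<bar>) ` ({1..n} \<times> {1..n}))"

definition divisive_state ::
    "nat \<Rightarrow> real \<Rightarrow> nat \<Rightarrow> (nat \<Rightarrow> nat set) \<Rightarrow> (nat \<Rightarrow> real) \<Rightarrow> (nat \<Rightarrow> real) \<Rightarrow> bool" where
  "divisive_state n \<epsilon> Nc V xs y \<longleftrightarrow>
     2 \<le> Nc \<and> Nc \<le> n \<and>
     (\<forall>g\<in>{1..Nc}. V g \<noteq> {}) \<and>
     disjoint_family_on V {1..Nc} \<and>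
     (\<Union>g\<in>{1..Nc}. V g) = {1..n} \<and>
     (\<forall>p\<in>{1..Nc}. \<forall>q\<in>{1..Nc}. q < p \<longrightarrow> xs p - xs q > \<epsilon>) \<and>
     (\<forall>g\<in>{1..Nc}. \<forall>i\<in>V g. y i = xs g)"

text \<open>
  One sample path \<open>y\<close> driven by one noise realization \<open>z\<close>, which acts on agent 1 only;
  the value \<open>z 0\<close> is never used.
\<close>

definition hk_noisy_path :: "nat \<Rightarrow> real \<Rightarrow> (nat \<Rightarrow> real) \<Rightarrow> (nat \<Rightarrow> nat \<Rightarrow> real) \<Rightarrow> bool" where
  "hk_noisy_path n \<epsilon> z y \<longleftrightarrow>
     (\<forall>t. \<forall>i\<in>{1..n}.
        y (t + 1) i =
          1 / real (card (hk_neighbors n \<epsilon> (y t) i)) * (\<Sum>j\<in>hk_neighbors n \<epsilon> (y t) i. y t j)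
          + (if i = 1 then z (t + 1) else 0))"

text \<open>The infimum is taken in \<open>enat\<close>, so it is \<open>\<infinity>\<close> if the diameter never drops to \<open>\<epsilon>\<close>.\<close>

definition merging_time :: "nat \<Rightarrow> real \<Rightarrow> (nat \<Rightarrow> nat \<Rightarrow> real) \<Rightarrow> enat" where
  "merging_time n \<epsilon> y = Inf (enat ` {t. opinion_diameter n (y t) \<le> \<epsilon>})"

end

theory Submission
  imports Defs
begin

text \<open>
  The group around agent 1 is always a union of an initial segment of the clusters. It is either
  cohesive and out of sight of the remaining clusters, or agent 1 alone has come within reach of
  the next cluster; since \<open>2 n \<delta>\<^sub>2 \<le> \<epsilon>\<close>, in the latter case the next cluster joins in one step.
  In each step the mean of the group grows by at least the noise divided by the number of
  neighbors of agent 1, and before merging it stays below \<open>x\<^sup>*\<close> of the last cluster. If the noise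
  has positive mean, taking expectations bounds \<open>\<Sum>t. P (T > t)\<close>. If the noise is centered, then,
  before the first contact, the mean of the first group is a random walk with centered bounded
  steps; with positive probability it first moves away from the next cluster, and by optional
  stopping it then stays away for \<open>j\<close> further steps with probability at least of order \<open>1 / j\<close>.
\<close>

section \<open>Noise-free averages and the weight of agent 1\<close>

definition hk_average :: "nat \<Rightarrow> real \<Rightarrow> (nat \<Rightarrow> real) \<Rightarrow> nat \<Rightarrow> real" where
  "hk_average n \<epsilon> y i =
     1 / real (card (hk_neighbors n \<epsilon> y i)) * (\<Sum>j\<in>hk_neighbors n \<epsilon> y i. y j)"

lemma hk_noisy_path_step:
  assumes "hk_noisy_path n \<epsilon> z y" "i \<in> {1..n}"
  shows "y (Suc t) i = hk_average n \<epsilon> (y t) i + (if i = 1 then z (Suc t) else 0)"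
  using assms by (simp add: hk_noisy_path_def hk_average_def)

lemma opinion_diameter_le_iff:
  assumes "1 \<le> n"
  shows "opinion_diameter n y \<le> c \<longleftrightarrow> (\<forall>i\<in>{1..n}. \<forall>j\<in>{1..n}. \<bar>y i - y j\<bar> \<le> c)"
  using assms unfolding opinion_diameter_def by (subst Max_le_iff) auto

text \<open>The factor with which the noise enters the mean of the group: it hits agent 1 alone and
  is spread over the set of its neighbors.\<close>

definition hk_weight :: "nat \<Rightarrow> real \<Rightarrow> (nat \<Rightarrow> real) \<Rightarrow> real" where
  "hk_weight n \<epsilon> y = 1 / real (card (hk_neighbors n \<epsilon> y 1))"

lemma hk_weight_bounds: "0 \<le> hk_weight n \<epsilon> y" "hk_weight n \<epsilon> y \<le> 1"
  unfolding hk_weight_def by (cases "card (hk_neighbors n \<epsilon> y 1)", auto)+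

lemma hk_weight_ge:
  assumes "1 \<le> n" "0 \<le> \<epsilon>"
  shows "1 / real n \<le> hk_weight n \<epsilon> y"
proof -
  have "hk_neighbors n \<epsilon> y 1 \<subseteq> {1..n}" "1 \<in> hk_neighbors n \<epsilon> y 1"
    using assms by (auto simp: hk_neighbors_def)
  then have "card (hk_neighbors n \<epsilon> y 1) \<le> n" "0 < card (hk_neighbors n \<epsilon> y 1)"
    using card_mono[of "{1..n}" "hk_neighbors n \<epsilon> y 1"] finite_subset[of "hk_neighbors n \<epsilon> y 1"]
    by (auto simp: card_gt_0_iff)
  then show ?thesis unfolding hk_weight_def by (intro frac_le) auto
qed

section \<open>Evolution of the groups\<close>

text \<open>The deterministic setting. \<open>\<delta>\<close> bounds the noise in absolute value,
  so it becomes \<open>\<delta>2\<close> in the theorem, where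
  \<open>\<delta>1 \<le> \<delta>2\<close>.\<close>

locale hk_clusters =
  fixes n Nc :: nat and \<epsilon> \<delta> :: real and V :: "nat \<Rightarrow> nat set" and xs y0 :: "nat \<Rightarrow> real"
  assumes divisive: "divisive_state n \<epsilon> Nc V xs y0"
    and one_in_first: "1 \<in> V 1"
    and eps_pos: "0 < \<epsilon>"
    and delta_nonneg: "0 \<le> \<delta>"
    and delta_small: "2 * real n * \<delta> \<le> \<epsilon>"
begin

definition merged :: "nat \<Rightarrow> nat set" where
  "merged k = (\<Union>g\<in>{1..k}. V g)"

definition merged_mean :: "nat \<Rightarrow> (nat \<Rightarrow> real) \<Rightarrow> real" where
  "merged_mean k y = (\<Sum>j\<in>merged k. y j) / real (card (merged k))"

definition untouched :: "nat \<Rightarrow> (nat \<Rightarrow> real) \<Rightarrow> bool" where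
  "untouched k y \<longleftrightarrow> (\<forall>g\<in>{k<..Nc}. \<forall>i\<in>V g. y i = xs g)"

text \<open>The strict inequality keeps the next cluster out of sight, since agents at distance
  exactly \<open>\<epsilon>\<close> are neighbors. For \<open>k = Nc\<close> the state has
  merged.\<close>

definition cohesive :: "nat \<Rightarrow> (nat \<Rightarrow> real) \<Rightarrow> bool" where
  "cohesive k y \<longleftrightarrow> k \<in> {1..Nc} \<and> untouched k y \<and>
     (\<forall>i\<in>merged k. \<forall>j\<in>merged k. \<bar>y i - y j\<bar> \<le> \<epsilon>) \<and>
     (k < Nc \<longrightarrow> (\<forall>i\<in>merged k. y i < xs (Suc k) - \<epsilon>))"

text \<open>The state right after the noise has carried agent 1 into the reach of the next cluster.
  In use, \<open>b\<close> is the former mean of the group. It is a parameter because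
  \<open>merged k - {1}\<close> may be empty, and then \<open>y\<close> does not determine
  it.\<close>

definition bridging :: "nat \<Rightarrow> real \<Rightarrow> (nat \<Rightarrow> real) \<Rightarrow> bool" where
  "bridging k b y \<longleftrightarrow> k \<in> {1..<Nc} \<and> untouched k y \<and>
     (\<forall>i\<in>merged k - {1}. y i = b) \<and> b < xs (Suc k) - \<epsilon> \<and>
     xs (Suc k) - \<epsilon> \<le> y 1 \<and> y 1 \<le> b + \<delta>"

section \<open>Bookkeeping for clusters and agents\<close>

lemma Nc_ge: "2 \<le> Nc" and Nc_le: "Nc \<le> n"
  and V_disjoint: "disjoint_family_on V {1..Nc}"
  and V_Union: "(\<Union>g\<in>{1..Nc}. V g) = {1..n}"
  using divisive unfolding divisive_state_def by metis+

lemma V_nonempty: "g \<in> {1..Nc} \<Longrightarrow> V g \<noteq> {}"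
  using divisive unfolding divisive_state_def by metis

lemma xs_gap:
  assumes "p \<in> {1..Nc}" "q \<in> {1..Nc}" "q < p"
  shows "xs q + \<epsilon> < xs p"
proof -
  have "xs p - xs q > \<epsilon>"
    using divisive assms unfolding divisive_state_def by metis
  then show ?thesis by simp
qed

lemma y0_V: "g \<in> {1..Nc} \<Longrightarrow> i \<in> V g \<Longrightarrow> y0 i = xs g"
  using divisive unfolding divisive_state_def by metis

lemma n_ge: "2 \<le> n"
  using Nc_ge Nc_le by simp

lemma V_subset: "g \<in> {1..Nc} \<Longrightarrow> V g \<subseteq> {1..n}"
  unfolding V_Union[symmetric] by (rule UN_upper)

lemma xs_mono: "p \<in> {1..Nc} \<Longrightarrow> q \<in> {1..Nc} \<Longrightarrow> q \<le> p \<Longrightarrow> xs q \<le> xs p"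
  using xs_gap[of p q] eps_pos by (cases "q = p") auto

lemma merged_subset: "k \<le> Nc \<Longrightarrow> merged k \<subseteq> {1..n}"
  unfolding V_Union[symmetric] merged_def by (rule UN_mono) auto

lemma merged_all: "merged Nc = {1..n}"
  using V_Union by (simp add: merged_def)

lemma one_in_merged: "1 \<le> k \<Longrightarrow> 1 \<in> merged k"
  using one_in_first unfolding merged_def by force

lemma finite_merged: "k \<le> Nc \<Longrightarrow> finite (merged k)"
  using merged_subset finite_subset by blast

lemma finite_V: "g \<in> {1..Nc} \<Longrightarrow> finite (V g)"
  using V_subset finite_subset by blast

lemma merged_Suc: "merged (Suc k) = merged k \<union> V (Suc k)"
  by (simp add: merged_def atLeastAtMostSuc_conv Un_commute)

lemma merged_disjoint:
  assumes "k < g" "g \<le> Nc"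
  shows "merged k \<inter> V g = {}"
proof -
  have "V h \<inter> V g = {}" if "h \<in> {1..k}" for h
    using that assms by (intro disjoint_family_onD[OF V_disjoint]) auto
  then show ?thesis unfolding merged_def by blast
qed

lemma agent_cases:
  assumes "k \<le> Nc" "i \<in> {1..n}"
  obtains "i \<in> merged k" | g where "g \<in> {k<..Nc}" "i \<in> V g"
proof -
  obtain g where "g \<in> {1..Nc}" "i \<in> V g"
    using assms(2) unfolding V_Union[symmetric] by (rule UN_E)
  then show ?thesis
  proof (cases "g \<le> k")
    case True
    then have "g \<in> {1..k}" using \<open>g \<in> {1..Nc}\<close> by simp
    then have "i \<in> merged k" unfolding merged_def using \<open>i \<in> V g\<close> by blast
    then show ?thesis by (rule that(1))
  next
    case False
    then show ?thesis using that(2)[of g] \<open>g \<in> {1..Nc}\<close> \<open>i \<in> V g\<close> by simp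
  qed
qed

lemma card_merged_pos: "1 \<le> k \<Longrightarrow> k \<le> Nc \<Longrightarrow> 0 < card (merged k)"
  using one_in_merged finite_merged card_gt_0_iff by blast

lemma card_V_pos: "g \<in> {1..Nc} \<Longrightarrow> 0 < card (V g)"
  using V_nonempty finite_V card_gt_0_iff by blast

lemma card_merged_Suc:
  "Suc k \<le> Nc \<Longrightarrow> card (merged (Suc k)) = card (merged k) + card (V (Suc k))"
  unfolding merged_Suc using finite_merged[of k] finite_V[of "Suc k"] merged_disjoint[of k "Suc k"]
  by (subst card_Un_disjoint) auto

lemma card_merged_le: "k \<le> Nc \<Longrightarrow> card (merged k) \<le> n"
  using card_mono[OF _ merged_subset[of k]] by simp

section \<open>Neighbor sets and averages in cohesive states\<close>

lemma hk_neighbors_eqI: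
  assumes "k \<le> Nc"
    and "N \<subseteq> {1..n}"
    and "\<And>j. j \<in> N \<Longrightarrow> \<bar>y j - y i\<bar> \<le> \<epsilon>"
    and "\<And>j. j \<in> merged k \<Longrightarrow> j \<notin> N \<Longrightarrow> \<bar>y j - y i\<bar> > \<epsilon>"
    and "\<And>g j. g \<in> {k<..Nc} \<Longrightarrow> j \<in> V g \<Longrightarrow> j \<notin> N \<Longrightarrow> \<bar>y j - y i\<bar> > \<epsilon>"
  shows "hk_neighbors n \<epsilon> y i = N"
proof -
  have "j \<in> N" if "j \<in> {1..n}" "\<bar>y j - y i\<bar> \<le> \<epsilon>" for j
    using assms(1) that(1)
  proof (cases rule: agent_cases[of k j, case_names in_merged later, consumes 2])
    case in_merged
    then show ?thesis using that(2) assms(4)[of j] by force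
  next
    case (later g)
    then show ?thesis using that(2) assms(5)[of g j] by force
  qed
  then show ?thesis using assms(2,3) unfolding hk_neighbors_def by blast
qed

lemma hk_average_const:
  assumes "hk_neighbors n \<epsilon> y i = N" "N \<noteq> {}" "finite N" "\<And>j. j \<in> N \<Longrightarrow> y j = c"
  shows "hk_average n \<epsilon> y i = c"
  using assms by (simp add: hk_average_def)

text \<open>The lowest opinion outside the group is \<open>xs (Suc k)\<close>, and even that lies
  more than \<open>\<epsilon>\<close> above every member.\<close>

lemma cohesive_neighbors:
  assumes "cohesive k y" "i \<in> merged k"
  shows "hk_neighbors n \<epsilon> y i = merged k"
proof (rule hk_neighbors_eqI[of k])
  fix g j assume g: "g \<in> {k<..Nc}" "j \<in> V g"
  then have "y j = xs g" "y i < xs (Suc k) - \<epsilon>" "xs (Suc k) \<le> xs g"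
    using assms xs_mono[of g "Suc k"] unfolding cohesive_def untouched_def by auto
  then show "\<epsilon> < \<bar>y j - y i\<bar>" by simp
qed (use assms merged_subset[of k] in \<open>auto simp: cohesive_def\<close>)

text \<open>Distinct clusters differ by more than \<open>\<epsilon>\<close>, and the group lies more
  than \<open>\<epsilon>\<close> below all later ones.\<close>

lemma cohesive_neighbors_other:
  assumes "cohesive k y" "h \<in> {k<..Nc}" "i \<in> V h"
  shows "hk_neighbors n \<epsilon> y i = V h"
proof (rule hk_neighbors_eqI[of k])
  have i: "y i = xs h" using assms unfolding cohesive_def untouched_def by auto
  { fix g j assume g: "g \<in> {k<..Nc}" "j \<in> V g" "j \<notin> V h"
    then have "y j = xs g" "g \<noteq> h"
      using assms unfolding cohesive_def untouched_def by auto
    then show "\<epsilon> < \<bar>y j - y i\<bar>"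
      using i assms(2) g xs_gap[of g h] xs_gap[of h g] by (cases "g < h") auto }
  { fix j assume "j \<in> merged k"
    then have "y j < xs (Suc k) - \<epsilon>" "xs (Suc k) \<le> xs h"
      using assms(1,2) xs_mono[of h "Suc k"] unfolding cohesive_def by auto
    then show "\<epsilon> < \<bar>y j - y i\<bar>" using i by simp }
  { fix j assume "j \<in> V h"
    then show "\<bar>y j - y i\<bar> \<le> \<epsilon>"
      using i assms eps_pos unfolding cohesive_def untouched_def by auto }
qed (use assms V_subset[of h] in \<open>auto simp: cohesive_def\<close>)

lemma cohesive_average:
  assumes "cohesive k y" "i \<in> merged k"
  shows "hk_average n \<epsilon> y i = merged_mean k y"
  by (simp add: hk_average_def merged_mean_def cohesive_neighbors[OF assms])

lemma cohesive_average_other: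
  assumes "cohesive k y" "h \<in> {k<..Nc}" "i \<in> V h"
  shows "hk_average n \<epsilon> y i = xs h"
proof (rule hk_average_const[OF cohesive_neighbors_other[OF assms]])
  show "V h \<noteq> {}" "finite (V h)" using assms finite_V[of h] by auto
  show "y j = xs h" if "j \<in> V h" for j
    using that assms unfolding cohesive_def untouched_def by auto
qed

text \<open>Averaging makes all members but agent 1 agree, so sums over a group reduce to a constant
  and a single deviation.\<close>

lemma sum_remove_one:
  assumes "1 \<le> k" "k \<le> Nc" "\<And>i. i \<in> merged k - {1} \<Longrightarrow> y i = b"
  shows "(\<Sum>j\<in>merged k. y j) = real (card (merged k)) * b + (y 1 - b)"
proof -
  have "(\<Sum>j\<in>merged k. y j) = y 1 + (\<Sum>j\<in>merged k - {1}. y j)"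
    using assms one_in_merged finite_merged by (intro sum.remove) auto
  also have "(\<Sum>j\<in>merged k - {1}. y j) = real (card (merged k - {1})) * b"
    using assms(3) by simp
  also have "real (card (merged k - {1})) = real (card (merged k)) - 1"
    using assms one_in_merged[of k] finite_merged[of k] card_merged_pos[of k]
    by (simp add: card_Diff_singleton of_nat_diff)
  finally show ?thesis by (simp add: algebra_simps)
qed

lemma merged_mean_less:
  assumes "1 \<le> k" "k \<le> Nc" "\<And>i. i \<in> merged k \<Longrightarrow> y i < c"
  shows "merged_mean k y < c"
proof -
  have "(\<Sum>j\<in>merged k. y j) < (\<Sum>j\<in>merged k. c)"
    using assms finite_merged one_in_merged by (intro sum_strict_mono) auto
  then show ?thesis
    using card_merged_pos[OF assms(1,2)] by (simp add: merged_mean_def field_simps)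
qed

lemma delta_le: "\<delta> \<le> \<epsilon>"
proof -
  have "1 * \<delta> \<le> 2 * real n * \<delta>" using delta_nonneg n_ge by (intro mult_right_mono) auto
  then show ?thesis using delta_small by simp
qed

section \<open>One step from \<open>y\<close> to \<open>y'\<close> under the noise
  \<open>z\<close>\<close>

context
  fixes y y' :: "nat \<Rightarrow> real" and z :: real
  assumes step: "\<And>i. i \<in> {1..n} \<Longrightarrow> y' i = hk_average n \<epsilon> y i + (if i = 1 then z else 0)"
    and z_bound: "\<bar>z\<bar> \<le> \<delta>"
begin

text \<open>A later cluster averages over itself, and agent 1, the only one with noise, is not in
  it.\<close>

lemma cohesive_step_untouched:
  assumes "cohesive k y"
  shows "untouched k y'"
  unfolding untouched_def
proof (intro ballI)
  fix g i assume g: "g \<in> {k<..Nc}" "i \<in> V g"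
  have "k \<ge> 1" using assms by (simp add: cohesive_def)
  then have "i \<noteq> 1" using merged_disjoint[of k g] one_in_merged[of k] g by auto
  then show "y' i = xs g"
    using step[of i] cohesive_average_other[OF assms g] V_subset[of g] g by auto
qed

lemma cohesive_step_merged:
  assumes "cohesive k y" "i \<in> merged k"
  shows "y' i = merged_mean k y + (if i = 1 then z else 0)"
  using assms step[of i] cohesive_average[OF assms] merged_subset[of k]
  by (auto simp: cohesive_def)

lemma cohesive_step_mean:
  assumes "cohesive k y"
  shows "merged_mean k y' = merged_mean k y + z / real (card (merged k))"
proof -
  have k: "1 \<le> k" "k \<le> Nc" using assms by (auto simp: cohesive_def)
  have "(\<Sum>j\<in>merged k. y' j) = real (card (merged k)) * merged_mean k y + (y' 1 - merged_mean k y)"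
    using cohesive_step_merged[OF assms] by (intro sum_remove_one k) auto
  also have "y' 1 - merged_mean k y = z"
    using cohesive_step_merged[OF assms one_in_merged[OF k(1)]] by simp
  finally show ?thesis
    using card_merged_pos[OF k] by (simp add: merged_mean_def[of k y'] add_divide_distrib)
qed

text \<open>After the step all members sit at the old mean or at the old mean plus \<open>z\<close>,
  so their spread is at most \<open>\<delta> \<le> \<epsilon>\<close>. Only agent 1 could make
  contact with the next cluster, which the second assumption excludes.\<close>

lemma cohesive_step_cohesive:
  assumes "cohesive k y" "k < Nc \<Longrightarrow> merged_mean k y + z < xs (Suc k) - \<epsilon>"
  shows "cohesive k y'"
proof -
  have k: "1 \<le> k" "k \<le> Nc" using assms by (auto simp: cohesive_def)
  have "merged_mean k y < xs (Suc k) - \<epsilon>" if "k < Nc"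
    using assms(1) that k unfolding cohesive_def by (intro merged_mean_less) auto
  then show ?thesis
    using k assms(2) cohesive_step_untouched[OF assms(1)] cohesive_step_merged[OF assms(1)]
      z_bound delta_le eps_pos
    unfolding cohesive_def by auto
qed

text \<open>The complementary case: the old mean is still out of reach, so agent 1 alone makes
  contact and lies at most \<open>\<delta>\<close> above the others.\<close>

lemma cohesive_step_bridging:
  assumes "cohesive k y" "k < Nc" "merged_mean k y + z \<ge> xs (Suc k) - \<epsilon>"
  shows "bridging k (merged_mean k y) y'"
proof -
  have k: "1 \<le> k" "k \<le> Nc" using assms by (auto simp: cohesive_def)
  have "merged_mean k y < xs (Suc k) - \<epsilon>"
    using assms(1,2) k unfolding cohesive_def by (intro merged_mean_less) auto
  then show ?thesis
    using k assms(2,3) cohesive_step_untouched[OF assms(1)] cohesive_step_merged[OF assms(1)]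
      one_in_merged[of k] z_bound
    unfolding bridging_def by auto
qed

text \<open>
  The bound \<open>2 n \<delta> \<le> \<epsilon>\<close> enters here: agent 1 pulls the next cluster by at least
  \<open>(\<epsilon> - \<delta>) / n \<ge> \<delta>\<close>, which makes up for the overshoot of \<open>\<delta>\<close>.
\<close>

lemma bridging_step:
  assumes br: "bridging k b y"
  shows "hk_neighbors n \<epsilon> y 1 = merged (Suc k)"
    and "cohesive (Suc k) y'"
    and "merged_mean k y + z / real (card (merged (Suc k))) \<le> merged_mean (Suc k) y'"
proof -
  define U W s a where defs: "U = merged k" "W = V (Suc k)" "s = xs (Suc k)" "a = y 1"
  define m p where mp: "m = real (card U)" "p = real (card W)"
  \<comment> \<open>\<open>b'\<close> is the present mean of the group and the next value of its
    members other than agent 1. \<open>s'\<close> is the next value of the cluster \<open>W\<close>,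
    which averages \<open>p\<close> members at \<open>s\<close> and agent 1 at
    \<open>a\<close>.\<close>
  define b' s' where b's': "b' = b + (a - b) / m" "s' = s - (s - a) / (p + 1)"
  have k: "1 \<le> k" "k < Nc" and unt: "untouched k y" and U1: "\<And>i. i \<in> U - {1} \<Longrightarrow> y i = b"
    and b: "b < s - \<epsilon>" and a: "s - \<epsilon> \<le> a" "a \<le> b + \<delta>"
    using br unfolding bridging_def defs by auto
  have one: "1 \<in> U" "1 \<notin> W"
    using one_in_merged[of k] merged_disjoint[of k "Suc k"] k by (auto simp: defs)
  have fin: "finite U" "finite W" "U \<inter> W = {}" "U \<subseteq> {1..n}" "W \<subseteq> {1..n}"
    using finite_merged[of k] finite_V[of "Suc k"] merged_disjoint[of k "Suc k"]
      merged_subset[of k] V_subset[of "Suc k"] k by (auto simp: defs)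
  have far: "y i \<ge> s + \<epsilon>" if "g \<in> {Suc k<..Nc}" "i \<in> V g" for g i
    using that unt xs_gap[of g "Suc k"] unfolding untouched_def defs by force
  have W: "y i = s" if "i \<in> W" for i
    using that k unt unfolding untouched_def defs by auto
  have m1: "1 \<le> m" and p1: "1 \<le> p" and mpn: "m + p \<le> real n"
    using card_merged_pos[of k] card_V_pos[of "Suc k"] card_merged_Suc[of k]
      card_merged_le[of "Suc k"] k unfolding mp defs by auto
  have small: "2 * real n * \<delta> \<le> \<epsilon>" by (rule delta_small)
  \<comment> \<open>From \<open>n \<ge> 2\<close>. The resulting
    \<open>4 * \<delta> \<le> \<epsilon>\<close> keeps agent 1 below \<open>s\<close> in spite of
    its overshoot.\<close>
  have "4 * \<delta> \<le> 2 * real n * \<delta>"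
    using n_ge delta_nonneg by (intro mult_right_mono) auto
  then have de: "4 * \<delta> \<le> \<epsilon>" using small by (rule order_trans)
  have as: "a < s" using a b de delta_nonneg by simp

  have ya: "y (Suc 0) = a" by (simp add: defs)
  have card_eq: "real (card (merged (Suc k))) = m + p"
    using card_merged_Suc[of k] k unfolding mp defs by simp
  have sumU: "(\<Sum>j\<in>U. y j) = m * b + (a - b)"
    unfolding mp defs using k U1 by (intro sum_remove_one) (auto simp: defs)
  have mean_U: "merged_mean k y = b'"
    using sumU m1 unfolding merged_mean_def b's' by (simp add: mp defs field_simps)

  show N1: "hk_neighbors n \<epsilon> y 1 = merged (Suc k)"
  proof (rule hk_neighbors_eqI[of "Suc k"])
    fix j assume "j \<in> merged (Suc k)"
    then consider "j = 1" | "j \<in> U - {1}" | "j \<in> W" unfolding merged_Suc defs by auto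
    then show "\<bar>y j - y 1\<bar> \<le> \<epsilon>"
      by cases (use U1 W a b as de delta_nonneg in \<open>auto simp: ya\<close>)
  next
    fix g j assume "g \<in> {Suc k<..Nc}" "j \<in> V g"
    from far[OF this] show "\<epsilon> < \<bar>y j - y 1\<bar>" using as by (simp add: ya)
  qed (use k merged_subset[of "Suc k"] in auto)
  \<comment> \<open>Agent 1 is the only link: the rest of the old group and the cluster
    \<open>W\<close> do not see each other yet.\<close>
  have NU: "hk_neighbors n \<epsilon> y i = U" if "i \<in> U - {1}" for i
  proof (rule hk_neighbors_eqI[of "Suc k"])
    fix j assume "j \<in> U"
    then consider "j = 1" | "j \<in> U - {1}" by auto
    then show "\<bar>y j - y i\<bar> \<le> \<epsilon>"
      by cases (use U1 that a b as de delta_nonneg in \<open>auto simp: ya\<close>)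
  next
    fix j assume "j \<in> merged (Suc k)" "j \<notin> U"
    then have "y j = s" using W unfolding merged_Suc defs by auto
    then show "\<epsilon> < \<bar>y j - y i\<bar>" using U1[OF that] b by simp
  next
    fix g j assume "g \<in> {Suc k<..Nc}" "j \<in> V g"
    from far[OF this] show "\<epsilon> < \<bar>y j - y i\<bar>" using U1[OF that] b eps_pos by simp
  qed (use k fin in auto)
  have NW: "hk_neighbors n \<epsilon> y i = insert 1 W" if "i \<in> W" for i
  proof (rule hk_neighbors_eqI[of "Suc k"])
    fix j assume "j \<in> insert 1 W"
    then show "\<bar>y j - y i\<bar> \<le> \<epsilon>"
      using W[OF that] W a as eps_pos by (auto simp: ya)
  next
    fix j assume "j \<in> merged (Suc k)" "j \<notin> insert 1 W"
    then have "y j = b" using U1 unfolding merged_Suc defs by auto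
    then show "\<epsilon> < \<bar>y j - y i\<bar>" using W[OF that] b by simp
  next
    fix g j assume g: "g \<in> {Suc k<..Nc}" "j \<in> V g" "j \<notin> insert 1 W"
    then have "y j = xs g" using unt unfolding untouched_def by auto
    then show "\<epsilon> < \<bar>y j - y i\<bar>" using W[OF that] xs_gap[of g "Suc k"] g by (auto simp: defs)
  qed (use k fin one in auto)
  have Nother: "hk_neighbors n \<epsilon> y i = V h" if h: "h \<in> {Suc k<..Nc}" "i \<in> V h" for h i
  proof (rule hk_neighbors_eqI[of "Suc k"])
    have i: "y i = xs h" "s + \<epsilon> < xs h"
      using h unt xs_gap[of h "Suc k"] by (auto simp: untouched_def defs)
    { fix j assume "j \<in> V h"
      then have "y j = xs h" using h unt by (auto simp: untouched_def)
      then show "\<bar>y j - y i\<bar> \<le> \<epsilon>" using i eps_pos by simp }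
    { fix j assume "j \<in> merged (Suc k)"
      then consider "j = 1" | "j \<in> U - {1}" | "j \<in> W" unfolding merged_Suc defs by auto
      then have "y j \<le> s"
        by cases (use U1 W as b eps_pos in \<open>auto simp: ya\<close>)
      then show "\<epsilon> < \<bar>y j - y i\<bar>" using i by simp }
    { fix g j assume g: "g \<in> {Suc k<..Nc}" "j \<in> V g" "j \<notin> V h"
      then have "y j = xs g" "g \<noteq> h" using unt unfolding untouched_def by auto
      then show "\<epsilon> < \<bar>y j - y i\<bar>"
        using i h g xs_gap[of g h] xs_gap[of h g] by (cases "g < h") auto }
  qed (use k h V_subset[of h] in auto)

  have y'U: "y' i = b'" if "i \<in> U - {1}" for i
  proof -
    have "hk_average n \<epsilon> y i = b'"
      unfolding hk_average_def NU[OF that] mean_U[symmetric] merged_mean_def defs by simp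
    then show ?thesis using step[of i] that fin by auto
  qed
  have y'W: "y' i = s'" if "i \<in> W" for i
  proof -
    have "(\<Sum>j\<in>insert 1 W. y j) = a + p * s"
      using one fin W by (simp add: mp ya)
    moreover have "real (card (insert 1 W)) = p + 1" using one fin by (simp add: mp)
    ultimately have "hk_average n \<epsilon> y i = s'"
      unfolding hk_average_def NW[OF that] using p1 by (simp add: b's' field_simps)
    moreover have "i \<noteq> 1" using that one by auto
    ultimately show ?thesis using step[of i] that fin by auto
  qed
  have y'1: "y' 1 = (m * b' + p * s) / (m + p) + z"
  proof -
    have "(\<Sum>j\<in>merged (Suc k). y j) = (\<Sum>j\<in>U. y j) + (\<Sum>j\<in>W. y j)"
      unfolding merged_Suc defs(1,2)[symmetric] using fin by (simp add: sum.union_disjoint)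
    also have "(\<Sum>j\<in>U. y j) = m * b'" unfolding sumU using m1 by (simp add: b's' field_simps)
    also have "(\<Sum>j\<in>W. y j) = p * s" using W by (simp add: mp)
    finally show ?thesis using step[of 1] n_ge unfolding hk_average_def N1 card_eq by simp
  qed
  have y'other: "untouched (Suc k) y'"
    unfolding untouched_def
  proof (intro ballI)
    fix g i assume g: "g \<in> {Suc k<..Nc}" "i \<in> V g"
    have "hk_average n \<epsilon> y i = xs g"
      using finite_V[of g] g unt
      by (intro hk_average_const[OF Nother[OF g]]) (auto simp: untouched_def)
    moreover have "i \<noteq> 1"
      using g merged_disjoint[of k g] one_in_merged[of k] k by auto
    ultimately show "y' i = xs g" using step[of i] g V_subset[of g] by auto
  qed

  have z: "- \<delta> \<le> z" "z \<le> \<delta>" using z_bound by auto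
  have ba: "b < a" using a b by simp
  have b'b: "b \<le> b'" "b' \<le> a"
    using ba m1 divide_left_mono[of 1 m "a - b"] unfolding b's' by auto
  \<comment> \<open>Together with \<open>dn\<close>: a share of \<open>1 / n\<close> in a distance
    of \<open>\<epsilon> - \<delta>\<close> amounts to at least \<open>\<delta>\<close>.\<close>
  have quotient: "2 * \<delta> - \<delta> / real n \<le> (\<epsilon> - \<delta>) / real n"
    using small n_ge by (simp add: field_simps)
  have dn: "\<delta> / real n \<le> \<delta>"
    using divide_left_mono[of 1 "real n" \<delta>] delta_nonneg n_ge by simp
  \<comment> \<open>\<open>\<alpha>\<close> is the share of the old group in the enlarged one,
    bounded away from 0 and 1 since both parts are nonempty; \<open>\<beta>\<close> below is the
    share of agent 1 among the neighbors of \<open>W\<close>.\<close>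
  define \<alpha> where "\<alpha> = m / (m + p)"
  have \<alpha>: "1 / real n \<le> \<alpha>" "\<alpha> \<le> 1 - 1 / real n"
  proof -
    show "1 / real n \<le> \<alpha>" unfolding \<alpha>_def using m1 p1 mpn by (intro frac_le) auto
    have "1 / real n \<le> p / (m + p)" using m1 p1 mpn by (intro frac_le) auto
    also have "p / (m + p) = 1 - \<alpha>" unfolding \<alpha>_def using m1 p1 by (simp add: field_simps)
    finally show "\<alpha> \<le> 1 - 1 / real n" by simp
  qed
  define \<beta> where "\<beta> = 1 / (p + 1)"
  have \<beta>: "1 / real n \<le> \<beta>" "\<beta> \<le> 1"
    unfolding \<beta>_def using m1 p1 mpn by (auto intro!: frac_le)
  have pos: "0 \<le> \<alpha>" "0 \<le> \<beta>" unfolding \<alpha>_def \<beta>_def using m1 p1 by auto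
  have y'1_eq: "y' 1 = s - \<alpha> * (s - b') + z"
    using m1 p1 unfolding y'1 \<alpha>_def by (simp add: field_simps)
  have s'_eq: "s' = s - \<beta> * (s - a)" unfolding b's' \<beta>_def by simp

  have gap: "\<epsilon> - \<delta> \<le> s - a" "s - a \<le> s - b'" "s - b' \<le> \<epsilon> + \<delta>"
    using a b b'b by auto
  have "1 / real n * (\<epsilon> - \<delta>) \<le> \<alpha> * (s - b')" "1 / real n * (\<epsilon> - \<delta>) \<le> \<beta> * (s - a)"
    using gap \<alpha> \<beta> pos de delta_nonneg n_ge by (intro mult_mono; simp)+
  \<comment> \<open>The first pull outweighs any noise, so agent 1 ends at or below
    \<open>s\<close>. The second makes up for the overshoot, so \<open>W\<close> ends within
    \<open>\<epsilon>\<close> of \<open>b'\<close>.\<close>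
  then have lo: "\<delta> \<le> \<alpha> * (s - b')" "\<delta> \<le> \<beta> * (s - a)"
    using quotient dn by auto
  have "\<alpha> * (s - b') \<le> (1 - 1 / real n) * (\<epsilon> + \<delta>)"
    "(1 - \<alpha>) * (s - b') \<le> (1 - 1 / real n) * (\<epsilon> + \<delta>)"
    using gap \<alpha> de delta_nonneg n_ge by (intro mult_mono; simp)+
  moreover have "(1 - 1 / real n) * (\<epsilon> + \<delta>) = (\<epsilon> + \<delta>) - \<epsilon> / real n - \<delta> / real n"
    by (simp add: algebra_simps add_divide_distrib)
  moreover have "2 * \<delta> \<le> \<epsilon> / real n" using small n_ge by (simp add: field_simps)
  moreover have "0 \<le> \<delta> / real n" using delta_nonneg by simp
  \<comment> \<open>These two leave a margin of \<open>\<delta>\<close> on either side of agent 1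
    for its noise.\<close>
  ultimately have hi: "\<alpha> * (s - b') \<le> \<epsilon> - \<delta>" "(s - b') - \<alpha> * (s - b') \<le> \<epsilon> - \<delta>"
    by (auto simp: left_diff_distrib)
  have \<beta>a: "\<beta> * (s - a) \<le> s - a"
    using \<beta> pos as by (intro mult_left_le_one_le) auto

  have pair: "\<bar>y' 1 - b'\<bar> \<le> \<epsilon>" "\<bar>y' 1 - s'\<bar> \<le> \<epsilon>" "\<bar>b' - s'\<bar> \<le> \<epsilon>"
    and top: "y' 1 \<le> s" "b' \<le> s" "s' \<le> s" and low: "b' \<le> s'"
    unfolding y'1_eq s'_eq using lo hi gap \<beta>a z as a b'b de delta_nonneg by linarith+

  have "merged (Suc k) = insert 1 ((U - {1}) \<union> W)" using one unfolding merged_Suc defs by auto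
  then have vals: "y' i \<in> {y' 1, b', s'}" if "i \<in> merged (Suc k)" for i
    using that y'U y'W by auto
  show "cohesive (Suc k) y'"
    unfolding cohesive_def
  proof (intro conjI ballI impI)
    fix i j assume "i \<in> merged (Suc k)" "j \<in> merged (Suc k)"
    then show "\<bar>y' i - y' j\<bar> \<le> \<epsilon>"
      using vals[of i] vals[of j] pair eps_pos by (auto simp: abs_minus_commute)
  next
    fix i assume "Suc k < Nc" "i \<in> merged (Suc k)"
    then show "y' i < xs (Suc (Suc k)) - \<epsilon>"
      using vals[of i] top xs_gap[of "Suc (Suc k)" "Suc k"] by (auto simp: defs)
  qed (use k y'other in auto)

  have "(\<Sum>j\<in>merged (Suc k). y' j) = (\<Sum>j\<in>U. y' j) + (\<Sum>j\<in>W. y' j)"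
    unfolding merged_Suc defs(1,2)[symmetric] using fin by (simp add: sum.union_disjoint)
  also have "(\<Sum>j\<in>U. y' j) = m * b' + (y' 1 - b')"
    unfolding mp defs using k y'U by (intro sum_remove_one) (auto simp: defs)
  also have "(\<Sum>j\<in>W. y' j) = p * s'" using y'W by (simp add: mp)
  finally have "(\<Sum>j\<in>merged (Suc k). y' j) = m * b' + (y' 1 - b') + p * s'" .
  \<comment> \<open>For the lower bound on the new mean, members of \<open>W\<close> count as
    \<open>b'\<close> and agent 1 as \<open>b' + z\<close>.\<close>
  moreover have "p * b' \<le> p * s'" using low p1 by (intro mult_left_mono) auto
  moreover have "\<alpha> * (s - b') \<le> s - b'"
    using \<alpha> gap as n_ge m1 p1 by (intro mult_left_le_one_le) (auto simp: \<alpha>_def)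
  ultimately have "m * b' + z + p * b' \<le> (\<Sum>j\<in>merged (Suc k). y' j)"
    using y'1_eq by simp
  then have "(m * b' + z + p * b') / (m + p) \<le> merged_mean (Suc k) y'"
    unfolding merged_mean_def card_eq using m1 p1 by (intro divide_right_mono) auto
  moreover have "(m * b' + z + p * b') / (m + p) = b' + z / (m + p)"
    using m1 p1 by (simp add: field_simps)
  ultimately show "merged_mean k y + z / real (card (merged (Suc k))) \<le> merged_mean (Suc k) y'"
    unfolding mean_U card_eq by simp
qed

text \<open>In either kind of state agent 1 averages over exactly the group that is tracked at the
  next step, so the noise enters its mean with the factor \<open>hk_weight\<close>. When a cluster
  joins, the mean can only gain more than that.\<close>

lemma invariant_step:
  assumes "cohesive k y \<or> (\<exists>b. bridging k b y)"
  shows "\<exists>k'. (cohesive k' y' \<or> (\<exists>b. bridging k' b y')) \<and>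
           merged_mean k y + z * hk_weight n \<epsilon> y \<le> merged_mean k' y'"
  using assms
proof (elim disjE exE)
  assume c: "cohesive k y"
  then have "1 \<le> k" by (simp add: cohesive_def)
  then have "hk_neighbors n \<epsilon> y 1 = merged k" by (intro cohesive_neighbors c one_in_merged)
  then have "merged_mean k y' = merged_mean k y + z * hk_weight n \<epsilon> y"
    using cohesive_step_mean[OF c] by (simp add: hk_weight_def)
  moreover have "cohesive k y' \<or> (\<exists>b. bridging k b y')"
    using cohesive_step_cohesive[OF c] cohesive_step_bridging[OF c] by (metis not_le)
  ultimately show ?thesis by (intro exI[of _ k]) simp
next
  fix b assume "bridging k b y"
  note br = bridging_step[OF this]
  show ?thesis using br(2,3) unfolding hk_weight_def br(1) by (intro exI[of _ "Suc k"]) simp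
qed

end

text \<open>Stated for any divisive \<open>y\<close> and not just for \<open>y0\<close>, because the
  initial profiles of different outcomes are only tied together on the agents
  \<open>{1..n}\<close>.\<close>

lemma initial_cohesive:
  assumes "divisive_state n \<epsilon> Nc V xs y"
  shows "cohesive 1 y" "merged_mean 1 y = xs 1"
proof -
  have y: "y i = xs g" if "g \<in> {1..Nc}" "i \<in> V g" for g i
    using assms that unfolding divisive_state_def by metis
  have m: "merged 1 = V 1" by (simp add: merged_def)
  show "cohesive 1 y"
    unfolding cohesive_def untouched_def m
  proof (intro conjI ballI impI)
    show "1 \<in> {1..Nc}" using Nc_ge by simp
  next
    fix g i assume "g \<in> {1<..Nc}" "i \<in> V g"
    then show "y i = xs g" by (intro y) auto
  next
    fix i j assume "i \<in> V 1" "j \<in> V 1"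
    then show "\<bar>y i - y j\<bar> \<le> \<epsilon>" using y[of 1] Nc_ge eps_pos by auto
  next
    fix i assume "i \<in> V 1"
    then show "y i < xs (Suc 1) - \<epsilon>" using y[of 1 i] xs_gap[of 2 1] Nc_ge by (auto simp: numeral_2_eq_2)
  qed
  have "(\<Sum>j\<in>V 1. y j) = (\<Sum>j\<in>V 1. xs 1)" using Nc_ge by (intro sum.cong y) auto
  then show "merged_mean 1 y = xs 1"
    using card_V_pos[of 1] Nc_ge unfolding merged_mean_def m by simp
qed

section \<open>Diameter, and the mean before merging\<close>

lemma diameter_le_if_cohesive:
  assumes "cohesive Nc y"
  shows "opinion_diameter n y \<le> \<epsilon>"
  using assms n_ge unfolding cohesive_def merged_all by (subst opinion_diameter_le_iff) auto

text \<open>Agent 1 and any member of the next cluster are witnesses.\<close>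

lemma diameter_gt_if_cohesive:
  assumes "cohesive k y" "k < Nc"
  shows "\<epsilon> < opinion_diameter n y"
proof -
  obtain i where i: "i \<in> V (Suc k)" using V_nonempty[of "Suc k"] assms(2) by auto
  then have "y i = xs (Suc k)" "y 1 < xs (Suc k) - \<epsilon>"
    using assms one_in_merged[of k] unfolding cohesive_def untouched_def by auto
  then have "\<not> \<bar>y i - y 1\<bar> \<le> \<epsilon>" by simp
  moreover have "i \<in> {1..n}" "1 \<in> {1..n}" using V_subset[of "Suc k"] i assms(2) n_ge by auto
  moreover have "1 \<le> n" using n_ge by simp
  ultimately have "\<not> opinion_diameter n y \<le> \<epsilon>"
    unfolding opinion_diameter_le_iff[OF \<open>1 \<le> n\<close>] by blast
  then show ?thesis by simp
qed

text \<open>Before merging, some cluster is still ahead, and members of the group pass the edge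
  \<open>xs (Suc k) - \<epsilon>\<close> of its reach by less than \<open>2 * \<delta>\<close>.
  Since \<open>4 * \<delta> \<le> \<epsilon>\<close>, a margin of \<open>\<delta>\<close> is left,
  enough to absorb one more noise term.\<close>

lemma merged_mean_upper:
  assumes "cohesive k y \<or> (\<exists>b. bridging k b y)" "\<epsilon> < opinion_diameter n y"
  shows "merged_mean k y < xs Nc - \<delta>"
proof -
  have "k \<noteq> Nc" if "cohesive k y" using that assms(2) diameter_le_if_cohesive[of y] by auto
  then have k: "1 \<le> k" "k < Nc"
    using assms(1) unfolding cohesive_def bridging_def by auto
  have "4 * \<delta> \<le> 2 * real n * \<delta>"
    using n_ge delta_nonneg by (intro mult_right_mono) auto
  then have de: "4 * \<delta> \<le> \<epsilon>" using delta_small by (rule order_trans)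
  have "y i < xs (Suc k) - \<epsilon> + 2 * \<delta>" if "i \<in> merged k" for i
    using assms(1)
  proof (elim disjE exE)
    assume "cohesive k y"
    then show ?thesis using that k delta_nonneg unfolding cohesive_def by fastforce
  next
    fix b assume "bridging k b y"
    then have "y i = b \<or> y i = y 1" "b < xs (Suc k) - \<epsilon>" "y 1 \<le> b + \<delta>"
      using that unfolding bridging_def by auto
    then show ?thesis using delta_nonneg by auto
  qed
  then have "merged_mean k y < xs (Suc k) - \<epsilon> + 2 * \<delta>" using k by (intro merged_mean_less) auto
  then show ?thesis using xs_mono[of Nc "Suc k"] k de delta_nonneg by simp
qed

section \<open>Sample paths with bounded noise\<close>

context
  fixes y :: "nat \<Rightarrow> nat \<Rightarrow> real" and z :: "nat \<Rightarrow> real"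
  assumes path: "hk_noisy_path n \<epsilon> z y"
    and init: "divisive_state n \<epsilon> Nc V xs (y 0)"
    and noise: "\<And>t. 1 \<le> t \<Longrightarrow> \<bar>z t\<bar> \<le> \<delta>"
begin

lemma path_invariant:
  "\<exists>k. (cohesive k (y t) \<or> (\<exists>b. bridging k b (y t))) \<and>
     xs 1 + (\<Sum>s<t. z (Suc s) * hk_weight n \<epsilon> (y s)) \<le> merged_mean k (y t)"
proof (induction t)
  case 0
  then show ?case using initial_cohesive[OF init] by (intro exI[of _ 1]) simp
next
  case (Suc t)
  then obtain k where k: "cohesive k (y t) \<or> (\<exists>b. bridging k b (y t))"
    "xs 1 + (\<Sum>s<t. z (Suc s) * hk_weight n \<epsilon> (y s)) \<le> merged_mean k (y t)" by blast
  obtain k' where "cohesive k' (y (Suc t)) \<or> (\<exists>b. bridging k' b (y (Suc t)))"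
    "merged_mean k (y t) + z (Suc t) * hk_weight n \<epsilon> (y t) \<le> merged_mean k' (y (Suc t))"
    using invariant_step[OF hk_noisy_path_step[OF path] noise[of "Suc t"] k(1)] by auto
  then show ?case using k(2) by (intro exI[of _ k']) auto
qed

text \<open>Until merging, \<open>xs 1\<close> plus the sum is a lower bound of the group mean; the
  margin in \<open>merged_mean_upper\<close> covers the last term, and afterwards the sum is frozen.
  The coefficient of \<open>z (Suc t)\<close> depends on the profiles up to time \<open>t\<close>
  only, which later lets expectations factor.\<close>

lemma stopped_sum_le:
  "(\<Sum>t<N. (if \<forall>s\<le>t. \<epsilon> < opinion_diameter n (y s) then hk_weight n \<epsilon> (y t) else 0) * z (Suc t))
     \<le> xs Nc - xs 1"
proof (induction N)
  case 0
  then show ?case using xs_mono[of Nc 1] Nc_ge by simp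
next
  case (Suc N)
  show ?case
  proof (cases "\<forall>s\<le>N. \<epsilon> < opinion_diameter n (y s)")
    case True
    obtain k where k: "cohesive k (y N) \<or> (\<exists>b. bridging k b (y N))"
      "xs 1 + (\<Sum>s<N. z (Suc s) * hk_weight n \<epsilon> (y s)) \<le> merged_mean k (y N)"
      using path_invariant by blast
    have "merged_mean k (y N) < xs Nc - \<delta>" using True by (intro merged_mean_upper[OF k(1)]) simp
    moreover have "\<bar>hk_weight n \<epsilon> (y N) * z (Suc N)\<bar> \<le> 1 * \<delta>"
      unfolding abs_mult using hk_weight_bounds noise by (intro mult_mono) auto
    moreover have "(\<Sum>t<N. (if \<forall>s\<le>t. \<epsilon> < opinion_diameter n (y s) then hk_weight n \<epsilon> (y t) else 0)
        * z (Suc t)) = (\<Sum>s<N. z (Suc s) * hk_weight n \<epsilon> (y s))"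
      using True by (intro sum.cong) auto
    ultimately show ?thesis using k(2) True by simp
  next
    case False
    then show ?thesis using Suc.IH unfolding sum.lessThan_Suc if_not_P[OF False] by simp
  qed
qed

text \<open>Contact is prevented in two ways: up to time \<open>t0\<close> the noise never pushes
  upwards, and from then on the mean is more than \<open>\<delta>\<close> below the reach of the
  second cluster. The position at time \<open>N\<close> controls the step to
  \<open>Suc N\<close>.\<close>

lemma cohesive_while_walk_low:
  assumes down: "\<And>s. s \<in> {1..t0} \<Longrightarrow> z s \<le> 0"
    and low: "\<And>s. s \<in> {t0..N} \<Longrightarrow>
      xs 1 + (\<Sum>r<s. z (Suc r)) / real (card (V 1)) < xs 2 - \<epsilon> - \<delta>"
    and "t \<le> Suc N"
  shows "cohesive 1 (y t) \<and> merged_mean 1 (y t) = xs 1 + (\<Sum>r<t. z (Suc r)) / real (card (V 1))"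
  using assms(3)
proof (induction t)
  case 0
  then show ?case using initial_cohesive[OF init] by simp
next
  case (Suc t)
  then have c: "cohesive 1 (y t)"
    and mean: "merged_mean 1 (y t) = xs 1 + (\<Sum>r<t. z (Suc r)) / real (card (V 1))" by auto
  note step = hk_noisy_path_step[OF path] noise[of "Suc t", simplified]
  have "merged_mean 1 (y t) < xs (Suc 1) - \<epsilon>"
    using c Nc_ge unfolding cohesive_def by (intro merged_mean_less) auto
  moreover have "z (Suc t) \<le> 0 \<or> merged_mean 1 (y t) < xs (Suc 1) - \<epsilon> - \<delta>"
    using down[of "Suc t"] low[of t] Suc.prems mean by (cases "t < t0") (auto simp: numeral_2_eq_2)
  ultimately have "merged_mean 1 (y t) + z (Suc t) < xs (Suc 1) - \<epsilon>"
    using step(2) by auto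
  then have "cohesive 1 (y (Suc t))" by (intro cohesive_step_cohesive[OF step c])
  moreover have "merged 1 = V 1" by (simp add: merged_def)
  then have "merged_mean 1 (y (Suc t)) = merged_mean 1 (y t) + z (Suc t) / real (card (V 1))"
    using cohesive_step_mean[OF step c] by simp
  ultimately show ?case unfolding mean by (simp add: add_divide_distrib)
qed

end

end

section \<open>Noise and measurability\<close>

lemma (in prob_space) uniform_measure_distributed:
  fixes X :: "'a \<Rightarrow> real"
  assumes "distr M borel X = uniform_measure lborel {a..b}" "X \<in> borel_measurable M" "a < b"
  shows "distributed M lborel X (\<lambda>x. indicator {a..b} x / measure lborel {a..b})"
proof -
  have "distr M lborel X = distr M borel X" by (rule distr_cong) simp_all
  also have "\<dots> = density lborel (\<lambda>x. ennreal (indicator {a..b} x / measure lborel {a..b}))"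
    unfolding assms(1) uniform_measure_def
  proof (intro density_cong AE_I2)
    fix x :: real
    show "indicator {a..b} x / emeasure lborel {a..b}
        = ennreal (indicator {a..b} x / measure lborel {a..b})"
      using assms(3) divide_ennreal[of 1 "b - a"] by (simp split: split_indicator)
  qed simp_all
  finally show ?thesis using assms(2) by (simp add: distributed_def)
qed

text \<open>The distribution function is 0 at \<open>a\<close> and 1 at \<open>b\<close>.\<close>

lemma (in prob_space) uniform_distributed_AE_bounds:
  fixes X :: "'a \<Rightarrow> real"
  assumes "distributed M lborel X (\<lambda>x. indicator {a..b} x / measure lborel {a..b})" "a < b"
  shows "AE \<omega> in M. a \<le> X \<omega> \<and> X \<omega> \<le> b"
proof -
  have [measurable]: "X \<in> borel_measurable M" using distributed_measurable[OF assms(1)] by simp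
  have "prob {\<omega> \<in> space M. X \<omega> \<le> a} = 0" "prob {\<omega> \<in> space M. X \<omega> \<le> b} = 1"
    using uniform_distributed_measure[OF assms(1)] assms(2) by simp_all
  then have "AE \<omega> in M. \<not> X \<omega> \<le> a" "AE \<omega> in M. X \<omega> \<le> b"
    by (simp_all add: prob_Collect_eq_0 prob_Collect_eq_1)
  then show ?thesis by eventually_elim simp
qed

text \<open>\<open>F\<close> sees the noise up to time \<open>t\<close> only, so it is independent
  of \<open>\<xi> (Suc t)\<close>. Both the drift argument and optional stopping rest on this
  factorization.\<close>

lemma (in prob_space) expectation_past_mult:
  fixes \<xi> :: "nat \<Rightarrow> 'a \<Rightarrow> real"
  assumes ind: "indep_vars (\<lambda>_. borel) \<xi> {1..}"
    and F: "F \<in> borel_measurable (PiM {1..t} (\<lambda>_. borel))"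
    and bound: "\<And>w. \<bar>F w\<bar> \<le> C"
    and int: "integrable M (\<xi> (Suc t))"
  shows "integrable M (\<lambda>\<omega>. F (\<lambda>s\<in>{1..t}. \<xi> s \<omega>))"
    and "integrable M (\<lambda>\<omega>. F (\<lambda>s\<in>{1..t}. \<xi> s \<omega>) * \<xi> (Suc t) \<omega>)"
    and "expectation (\<lambda>\<omega>. F (\<lambda>s\<in>{1..t}. \<xi> s \<omega>) * \<xi> (Suc t) \<omega>)
       = expectation (\<lambda>\<omega>. F (\<lambda>s\<in>{1..t}. \<xi> s \<omega>)) * expectation (\<xi> (Suc t))"
proof -
  have "indep_var (PiM {1..t} (\<lambda>_. borel)) (\<lambda>\<omega>. \<lambda>s\<in>{1..t}. \<xi> s \<omega>)
      (PiM {Suc t} (\<lambda>_. borel)) (\<lambda>\<omega>. \<lambda>s\<in>{Suc t}. \<xi> s \<omega>)"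
    using ind by (rule indep_var_restrict) auto
  then have "indep_var borel (F \<circ> (\<lambda>\<omega>. \<lambda>s\<in>{1..t}. \<xi> s \<omega>))
      borel ((\<lambda>w. w (Suc t)) \<circ> (\<lambda>\<omega>. \<lambda>s\<in>{Suc t}. \<xi> s \<omega>))"
    using F by (rule indep_var_compose) (rule measurable_component_singleton, simp)
  then have iv: "indep_var borel (\<lambda>\<omega>. F (\<lambda>s\<in>{1..t}. \<xi> s \<omega>)) borel (\<xi> (Suc t))"
    by (simp add: comp_def)
  have "random_variable borel (\<lambda>\<omega>. F (\<lambda>s\<in>{1..t}. \<xi> s \<omega>))"
    using iv indep_var_rv1 by blast
  then show intF: "integrable M (\<lambda>\<omega>. F (\<lambda>s\<in>{1..t}. \<xi> s \<omega>))"
    using bound by (intro integrable_const_bound[of _ C]) auto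
  show "integrable M (\<lambda>\<omega>. F (\<lambda>s\<in>{1..t}. \<xi> s \<omega>) * \<xi> (Suc t) \<omega>)"
    "expectation (\<lambda>\<omega>. F (\<lambda>s\<in>{1..t}. \<xi> s \<omega>) * \<xi> (Suc t) \<omega>)
       = expectation (\<lambda>\<omega>. F (\<lambda>s\<in>{1..t}. \<xi> s \<omega>)) * expectation (\<xi> (Suc t))"
    using indep_var_integrable[OF iv intF int] indep_var_lebesgue_integral[OF iv intF int] by auto
qed

text \<open>The dynamics as an explicit function of the noise sequence. The given process is
  constrained on agents and on \<open>space M\<close> only; measurability and dependence on the past
  are proved for this version and transferred.\<close>

primrec hk_state ::
    "nat \<Rightarrow> real \<Rightarrow> (nat \<Rightarrow> real) \<Rightarrow> (nat \<Rightarrow> real) \<Rightarrow> nat \<Rightarrow> nat \<Rightarrow> real" where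
  "hk_state n \<epsilon> y0 z 0 = y0"
| "hk_state n \<epsilon> y0 z (Suc t) =
     (\<lambda>i. hk_average n \<epsilon> (hk_state n \<epsilon> y0 z t) i + (if i = 1 then z (Suc t) else 0))"

section \<open>Locality, dependence on the past and measurability of the state\<close>

lemma hk_neighbors_cong:
  "(\<And>j. j \<in> {1..n} \<Longrightarrow> y j = y' j) \<Longrightarrow> i \<in> {1..n} \<Longrightarrow> hk_neighbors n \<epsilon> y i = hk_neighbors n \<epsilon> y' i"
  unfolding hk_neighbors_def by auto

lemma hk_average_cong:
  assumes "\<And>j. j \<in> {1..n} \<Longrightarrow> y j = y' j" "i \<in> {1..n}"
  shows "hk_average n \<epsilon> y i = hk_average n \<epsilon> y' i"
proof -
  have "(\<Sum>j\<in>hk_neighbors n \<epsilon> y' i. y j) = (\<Sum>j\<in>hk_neighbors n \<epsilon> y' i. y' j)"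
    using assms(1) by (intro sum.cong) (auto simp: hk_neighbors_def)
  moreover have "hk_neighbors n \<epsilon> y i = hk_neighbors n \<epsilon> y' i"
    using assms by (rule hk_neighbors_cong)
  ultimately show ?thesis unfolding hk_average_def by simp
qed

lemma hk_weight_cong:
  "(\<And>j. j \<in> {1..n} \<Longrightarrow> y j = y' j) \<Longrightarrow> 1 \<le> n \<Longrightarrow> hk_weight n \<epsilon> y = hk_weight n \<epsilon> y'"
  unfolding hk_weight_def by (subst hk_neighbors_cong[of n y y']) auto

lemma opinion_diameter_cong:
  "(\<And>j. j \<in> {1..n} \<Longrightarrow> y j = y' j) \<Longrightarrow> opinion_diameter n y = opinion_diameter n y'"
  unfolding opinion_diameter_def by (intro arg_cong[where f = Max] image_cong) auto

lemma hk_noisy_path_eq_state: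
  assumes "hk_noisy_path n \<epsilon> z y" "\<And>i. i \<in> {1..n} \<Longrightarrow> y 0 i = y0 i" "i \<in> {1..n}"
  shows "y t i = hk_state n \<epsilon> y0 z t i"
  using assms(3)
proof (induction t arbitrary: i)
  case (Suc t)
  then have "hk_average n \<epsilon> (y t) i = hk_average n \<epsilon> (hk_state n \<epsilon> y0 z t) i"
    by (intro hk_average_cong) auto
  then show ?case using hk_noisy_path_step[OF assms(1) Suc.prems] by simp
qed (use assms(2) in simp)

lemma hk_state_cong:
  "(\<And>s. s \<in> {1..t} \<Longrightarrow> z s = z' s) \<Longrightarrow> hk_state n \<epsilon> y0 z t = hk_state n \<epsilon> y0 z' t"
  by (induction t) (auto intro!: ext)

lemma measurable_hk_neighbors_card:
  assumes [measurable]: "\<And>j. (\<lambda>w. Y w j) \<in> borel_measurable N"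
  shows "(\<lambda>w. real (card (hk_neighbors n \<epsilon> (Y w) i))) \<in> borel_measurable N"
proof -
  \<comment> \<open>The varying index set is traded for indicators over the fixed set
    \<open>{1..n}\<close>.\<close>
  have "real (card (hk_neighbors n \<epsilon> (Y w) i))
      = (\<Sum>j\<in>{1..n}. if \<bar>Y w j - Y w i\<bar> \<le> \<epsilon> then 1 else 0)" for w
    by (simp add: hk_neighbors_def sum.If_cases Int_def)
  then show ?thesis by simp
qed

lemma measurable_hk_average:
  assumes [measurable]: "\<And>j. (\<lambda>w. Y w j) \<in> borel_measurable N"
  shows "(\<lambda>w. hk_average n \<epsilon> (Y w) i) \<in> borel_measurable N"
proof -
  have "(\<Sum>j\<in>hk_neighbors n \<epsilon> (Y w) i. Y w j)
      = (\<Sum>j\<in>{1..n}. if \<bar>Y w j - Y w i\<bar> \<le> \<epsilon> then Y w j else 0)" for w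
    by (simp add: hk_neighbors_def sum.If_cases Int_def)
  then have [measurable]: "(\<lambda>w. \<Sum>j\<in>hk_neighbors n \<epsilon> (Y w) i. Y w j) \<in> borel_measurable N" by simp
  note measurable_hk_neighbors_card[of Y N n \<epsilon> i, OF assms, measurable]
  show ?thesis unfolding hk_average_def by measurable
qed

lemma measurable_hk_state:
  assumes "\<And>s. s \<in> {1..t} \<Longrightarrow> (\<lambda>w. \<zeta> w s) \<in> borel_measurable N"
  shows "(\<lambda>w. hk_state n \<epsilon> y0 (\<zeta> w) t i) \<in> borel_measurable N"
  using assms
proof (induction t arbitrary: i)
  case (Suc t)
  have [measurable]: "(\<lambda>w. \<zeta> w (Suc t)) \<in> borel_measurable N" by (intro Suc.prems) simp
  have [measurable]: "(\<lambda>w. hk_average n \<epsilon> (hk_state n \<epsilon> y0 (\<zeta> w) t) i) \<in> borel_measurable N"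
    by (intro measurable_hk_average Suc.IH Suc.prems) auto
  show ?case unfolding hk_state.simps by measurable
qed simp

lemma measurable_opinion_diameter_gt:
  assumes [measurable]: "\<And>j. (\<lambda>w. Y w j) \<in> borel_measurable N" and "1 \<le> n"
  shows "Measurable.pred N (\<lambda>w. \<epsilon> < opinion_diameter n (Y w))"
  unfolding not_le[symmetric] opinion_diameter_le_iff[OF assms(2)] by measurable

lemma measurable_hk_weight:
  assumes "\<And>j. (\<lambda>w. Y w j) \<in> borel_measurable N"
  shows "(\<lambda>w. hk_weight n \<epsilon> (Y w)) \<in> borel_measurable N"
  unfolding hk_weight_def using measurable_hk_neighbors_card[OF assms] by measurable

section \<open>Tail events of the merging time\<close>

lemma less_merging_time_iff:
  "enat t < merging_time n \<epsilon> y \<longleftrightarrow> (\<forall>s\<le>t. \<epsilon> < opinion_diameter n (y s))"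
proof -
  have "enat t < merging_time n \<epsilon> y \<longleftrightarrow> enat (Suc t) \<le> merging_time n \<epsilon> y"
    by (simp add: Suc_ile_eq)
  also have "\<dots> \<longleftrightarrow> (\<forall>s. opinion_diameter n (y s) \<le> \<epsilon> \<longrightarrow> Suc t \<le> s)"
    unfolding merging_time_def by (simp add: le_Inf_iff)
  also have "\<dots> \<longleftrightarrow> (\<forall>s\<le>t. \<epsilon> < opinion_diameter n (y s))"
    by (metis not_less_eq_eq not_le)
  finally show ?thesis .
qed

text \<open>\<open>enat\<close> is countable, so singletons suffice: a finite value is a difference
  of tail events, and infinity is the intersection of all of them.\<close>

lemma measurable_enatI:
  assumes "\<And>t. Measurable.pred N (\<lambda>w. enat t < f w)"
  shows "f \<in> measurable N (count_space UNIV)"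
  unfolding measurable_count_space_eq2_countable
proof (intro conjI ballI)
  fix a :: enat
  note assms[measurable]
  show "f -` {a} \<inter> space N \<in> sets N"
  proof (cases a)
    case (enat k)
    have "f w = enat k \<longleftrightarrow> \<not> enat k < f w \<and> (\<forall>s<k. enat s < f w)" for w
      by (cases "f w") (auto simp: not_less intro: le_antisym leI)
    then have "f -` {a} \<inter> space N = {w \<in> space N. \<not> enat k < f w \<and> (\<forall>s<k. enat s < f w)}"
      unfolding enat by blast
    then show ?thesis by simp
  next
    case infinity
    have "f w = \<infinity> \<longleftrightarrow> (\<forall>s. enat s < f w)" for w by (cases "f w") auto
    then have "f -` {a} \<inter> space N = {w \<in> space N. \<forall>s. enat s < f w}"
      unfolding infinity by blast
    then show ?thesis by simp
  qed
qed simp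

section \<open>A stopped random walk\<close>

text \<open>The barrier \<open>K\<close> may be nonpositive. Therefore the walk is first pushed down
  by \<open>t0\<close> steps of at least \<open>c\<close> each, and is compared with
  \<open>K\<close> only from time \<open>t0\<close> on.\<close>

definition low_walk :: "nat \<Rightarrow> real \<Rightarrow> real \<Rightarrow> (nat \<Rightarrow> real) \<Rightarrow> nat \<Rightarrow> bool" where
  "low_walk t0 c K z t \<longleftrightarrow>
     (\<forall>s\<in>{1..t0}. z s \<le> - c) \<and> (\<forall>s\<in>{t0..t}. (\<Sum>r<s. z (Suc r)) < K)"

text \<open>
  A walk which starts below the barrier \<open>K\<close> by at least \<open>K + t0 * c\<close> and is frozen on
  reaching it has gained that much if it got there, and lost at most \<open>j * \<delta>\<close> if it did not.
\<close>

lemma stopped_walk_lower: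
  fixes z :: "nat \<Rightarrow> real"
  assumes noise: "\<And>t. 1 \<le> t \<Longrightarrow> \<bar>z t\<bar> \<le> \<delta>"
  shows "(K + real t0 * c) *
        (of_bool (low_walk t0 c K z t0) - of_bool (low_walk t0 c K z (t0 + j)))
      - real j * \<delta> * of_bool (low_walk t0 c K z (t0 + j))
    \<le> (\<Sum>i<j. of_bool (low_walk t0 c K z (t0 + i)) * z (Suc (t0 + i)))"
proof -
  define A where "A = low_walk t0 c K z"
  define R where "R t = (\<Sum>r<t. z (Suc r))" for t
  have A: "A t \<longleftrightarrow> (\<forall>s\<in>{1..t0}. z s \<le> - c) \<and> (\<forall>s\<in>{t0..t}. R s < K)" for t
    unfolding A_def low_walk_def R_def by simp
  have mono: "A t" if "A t'" "t \<le> t'" for t t' using that unfolding A by auto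
  have start: "R t0 \<le> - (real t0 * c)" if "A t0"
  proof -
    have "R t0 \<le> (\<Sum>r<t0. - c)" unfolding R_def using that A by (intro sum_mono) auto
    then show ?thesis by simp
  qed
  have lower: "- (real j * \<delta>) \<le> R (t0 + j) - R t0" for j
  proof (induction j)
    case (Suc j)
    then show ?case using noise[of "Suc (t0 + j)"] by (auto simp: R_def algebra_simps)
  qed simp
  \<comment> \<open>While the walk is low, the stopped sum telescopes. On exit it has risen from at
    most \<open>- t0 * c\<close> to at least \<open>K\<close>, and it keeps that value from then
    on.\<close>
  have inv: "if A (t0 + j) then (\<Sum>i<j. of_bool (A (t0 + i)) * z (Suc (t0 + i))) = R (t0 + j) - R t0
      else of_bool (A t0) * (K + real t0 * c) \<le> (\<Sum>i<j. of_bool (A (t0 + i)) * z (Suc (t0 + i)))"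
  proof (induction j)
    case (Suc j)
    show ?case
    proof (cases "A (t0 + j)")
      case True
      then have "(\<Sum>i<Suc j. of_bool (A (t0 + i)) * z (Suc (t0 + i))) = R (t0 + Suc j) - R t0"
        using Suc.IH by (simp add: R_def)
      moreover have "K \<le> R (t0 + Suc j)" if exit: "\<not> A (t0 + Suc j)"
      proof -
        obtain s where s: "s \<in> {t0..t0 + Suc j}" "\<not> R s < K"
          using True exit unfolding A by blast
        moreover have "s \<notin> {t0..t0 + j}" using True s(2) unfolding A by blast
        ultimately have "s = t0 + Suc j" by auto
        then show ?thesis using s(2) by simp
      qed
      ultimately show ?thesis using start mono[OF True] by auto
    next
      case False
      then show ?thesis using Suc.IH mono[of "t0 + Suc j" "t0 + j"] by auto
    qed
  qed (auto simp: A)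
  show ?thesis unfolding A_def[symmetric] using inv lower[of j] mono[of "t0 + j" t0] by (cases "A (t0 + j)") (auto simp: mult.commute)
qed

lemma low_walk_cong:
  assumes "t0 \<le> t" "\<And>s. s \<in> {1..t} \<Longrightarrow> z s = z' s"
  shows "low_walk t0 c K z t \<longleftrightarrow> low_walk t0 c K z' t"
proof -
  have "(\<Sum>r<s. z (Suc r)) = (\<Sum>r<s. z' (Suc r))" if "s \<le> t" for s
    using that assms(2) by (intro sum.cong) auto
  then show ?thesis using assms unfolding low_walk_def by auto
qed

lemma measurable_low_walk:
  assumes "t0 \<le> t" "\<And>s. s \<in> {1..t} \<Longrightarrow> (\<lambda>w. \<zeta> w s) \<in> borel_measurable N"
  shows "Measurable.pred N (\<lambda>w. low_walk t0 c K (\<zeta> w) t)"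
proof -
  \<comment> \<open>Extension by 0 makes every coordinate measurable, not just those up to
    \<open>t\<close>.\<close>
  define \<zeta>' where "\<zeta>' w s = (if s \<in> {1..t} then \<zeta> w s else 0)" for w s
  have [measurable]: "(\<lambda>w. \<zeta>' w s) \<in> borel_measurable N" for s
    unfolding \<zeta>'_def using assms(2) by (cases "s \<in> {1..t}") auto
  have "low_walk t0 c K (\<zeta> w) t = low_walk t0 c K (\<zeta>' w) t" for w
    using assms(1) by (rule low_walk_cong) (simp add: \<zeta>'_def)
  moreover have "Measurable.pred N (\<lambda>w. low_walk t0 c K (\<zeta>' w) t)"
    unfolding low_walk_def by measurable
  ultimately show ?thesis by simp
qed

text \<open>Optional stopping: the stopped sum of centered steps has expectation 0, so this is
  \<open>stopped_walk_lower\<close> after taking expectations. With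
  \<open>u = K + t0 * c > 0\<close> it says that \<open>p (t0 + j)\<close> is at least
  \<open>u * p t0 / (u + j * \<delta>)\<close>.\<close>

lemma (in prob_space) low_walk_prob_decay:
  fixes \<xi> :: "nat \<Rightarrow> 'a \<Rightarrow> real" and c K :: real and t0 :: nat
  assumes ind: "indep_vars (\<lambda>_. borel) \<xi> {1..}"
    and int: "\<And>t. 1 \<le> t \<Longrightarrow> integrable M (\<xi> t)"
    and mean: "\<And>t. 1 \<le> t \<Longrightarrow> expectation (\<xi> t) = 0"
    and bounded: "\<And>t. 1 \<le> t \<Longrightarrow> AE \<omega> in M. \<bar>\<xi> t \<omega>\<bar> \<le> \<delta>"
  defines "p \<equiv> \<lambda>t. prob {\<omega> \<in> space M. low_walk t0 c K (\<lambda>s. \<xi> s \<omega>) t}"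
  shows "(K + real t0 * c) * (p t0 - p (t0 + j)) \<le> real j * \<delta> * p (t0 + j)"
proof -
  define f :: "nat \<Rightarrow> 'a \<Rightarrow> real"
    where "f t \<omega> = of_bool (low_walk t0 c K (\<lambda>s. \<xi> s \<omega>) t)" for t \<omega>
  have rv: "\<xi> s \<in> borel_measurable M" if "1 \<le> s" for s using int[OF that] by auto
  have pred: "Measurable.pred M (\<lambda>\<omega>. low_walk t0 c K (\<lambda>s. \<xi> s \<omega>) t)" if "t0 \<le> t" for t
    using that rv by (intro measurable_low_walk) auto
  have f: "integrable M (f t)" "expectation (f t) = p t" if "t0 \<le> t" for t
  proof -
    note pred[OF that, measurable]
    have "f t = indicator {\<omega>. low_walk t0 c K (\<lambda>s. \<xi> s \<omega>) t}"
      unfolding f_def by (auto split: split_indicator)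
    then show "expectation (f t) = p t" unfolding p_def by (simp add: Int_def conj_commute)
    show "integrable M (f t)"
      unfolding f_def by (intro integrable_const_bound[of _ 1]) auto
  qed
  have mult: "integrable M (\<lambda>\<omega>. f t \<omega> * \<xi> (Suc t) \<omega>)"
    "expectation (\<lambda>\<omega>. f t \<omega> * \<xi> (Suc t) \<omega>) = 0" if "t0 \<le> t" for t
  proof -
    define F :: "(nat \<Rightarrow> real) \<Rightarrow> real" where "F w = of_bool (low_walk t0 c K w t)" for w
    have eq: "F (\<lambda>s\<in>{1..t}. \<xi> s \<omega>) = f t \<omega>" for \<omega>
      unfolding F_def f_def by (subst low_walk_cong[OF that]) auto
    have "Measurable.pred (PiM {1..t} (\<lambda>_. borel)) (\<lambda>w. low_walk t0 c K w t)"
      using that by (intro measurable_low_walk measurable_component_singleton) auto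
    then have F: "F \<in> borel_measurable (PiM {1..t} (\<lambda>_. borel))" unfolding F_def by measurable
    have b: "\<bar>F w\<bar> \<le> 1" for w unfolding F_def by simp
    note * = expectation_past_mult[OF ind F b int[of "Suc t"], unfolded eq]
    show "integrable M (\<lambda>\<omega>. f t \<omega> * \<xi> (Suc t) \<omega>)"
      "expectation (\<lambda>\<omega>. f t \<omega> * \<xi> (Suc t) \<omega>) = 0"
      using *(2,3) mean[of "Suc t"] by simp_all
  qed
  have "AE \<omega> in M. \<forall>t\<in>{1..}. \<bar>\<xi> t \<omega>\<bar> \<le> \<delta>"
    using bounded by (subst AE_ball_countable) auto
  then have "AE \<omega> in M. (K + real t0 * c) * (f t0 \<omega> - f (t0 + j) \<omega>) - real j * \<delta> * f (t0 + j) \<omega>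
      \<le> (\<Sum>i<j. f (t0 + i) \<omega> * \<xi> (Suc (t0 + i)) \<omega>)"
    unfolding f_def by eventually_elim (intro stopped_walk_lower, auto)
  then have "expectation (\<lambda>\<omega>. (K + real t0 * c) * (f t0 \<omega> - f (t0 + j) \<omega>) - real j * \<delta> * f (t0 + j) \<omega>)
      \<le> expectation (\<lambda>\<omega>. \<Sum>i<j. f (t0 + i) \<omega> * \<xi> (Suc (t0 + i)) \<omega>)"
    using f mult by (intro integral_mono_AE) auto
  also have "\<dots> = 0" using mult by (subst Bochner_Integration.integral_sum) auto
  also have "expectation (\<lambda>\<omega>. (K + real t0 * c) * (f t0 \<omega> - f (t0 + j) \<omega>) - real j * \<delta> * f (t0 + j) \<omega>)
      = (K + real t0 * c) * (p t0 - p (t0 + j)) - real j * \<delta> * p (t0 + j)"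
    using f by simp
  finally show ?thesis by simp
qed

text \<open>At time \<open>t0\<close> the \<open>t0\<close> downward steps already force the sum
  below \<open>K\<close>, so the event is an intersection of independent events of positive
  probability.\<close>

lemma (in prob_space) low_walk_start_prob:
  fixes \<xi> :: "nat \<Rightarrow> 'a \<Rightarrow> real"
  assumes ind: "indep_vars (\<lambda>_. borel) \<xi> {1..}"
    and pos: "\<And>t. 1 \<le> t \<Longrightarrow> 0 < prob {\<omega> \<in> space M. \<xi> t \<omega> \<le> - c}"
    and "1 \<le> t0" "0 < K + real t0 * c"
  shows "0 < prob {\<omega> \<in> space M. low_walk t0 c K (\<lambda>s. \<xi> s \<omega>) t0}"
proof -
  have walk: "low_walk t0 c K z t0 \<longleftrightarrow> (\<forall>s\<in>{1..t0}. z s \<le> - c)" for z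
  proof -
    have "(\<Sum>r<t0. z (Suc r)) < K" if "\<forall>s\<in>{1..t0}. z s \<le> - c"
    proof -
      have "(\<Sum>r<t0. z (Suc r)) \<le> (\<Sum>r<t0. - c)" using that by (intro sum_mono) auto
      then show ?thesis using assms(4) by simp
    qed
    then show ?thesis unfolding low_walk_def by auto
  qed
  have ne: "{1..t0} \<noteq> {}" using assms(3) by simp
  have "{\<omega> \<in> space M. low_walk t0 c K (\<lambda>s. \<xi> s \<omega>) t0}
      = (\<Inter>s\<in>{1..t0}. \<xi> s -` {..- c} \<inter> space M)"
    unfolding walk using ne by auto
  also have "prob \<dots> = (\<Prod>s\<in>{1..t0}. prob (\<xi> s -` {..- c} \<inter> space M))"
    using ne by (intro indep_varsD[OF ind]) auto
  also have "\<dots> > 0"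
  proof (intro prod_pos ballI)
    fix s assume "s \<in> {1..t0}"
    moreover have "\<xi> s -` {..- c} \<inter> space M = {\<omega> \<in> space M. \<xi> s \<omega> \<le> - c}" by auto
    ultimately show "0 < prob (\<xi> s -` {..- c} \<inter> space M)" using pos[of s] by simp
  qed
  finally show ?thesis .
qed

lemma suminf_ennreal_eq_top_if_harmonic:
  fixes p :: "nat \<Rightarrow> real"
  assumes "\<And>t. 0 \<le> p t" "0 < \<kappa>" "\<And>j. \<kappa> / real (Suc j) \<le> p (t0 + j)"
  shows "(\<Sum>t. ennreal (p t)) = \<infinity>"
proof (rule ccontr)
  assume "(\<Sum>t. ennreal (p t)) \<noteq> \<infinity>"
  then have "summable p" using assms(1) by (intro summable_suminf_not_top) auto
  then have "summable (\<lambda>j. p (j + t0))" by (rule summable_ignore_initial_segment)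
  then have "summable (\<lambda>j. \<kappa> / real (Suc j))"
    by (rule summable_comparison_test'[where N = 0]) (use assms in \<open>auto simp: add.commute\<close>)
  then have "summable (\<lambda>j. inverse \<kappa> * (\<kappa> / real (Suc j)))" by (rule summable_mult)
  then have "summable (\<lambda>j. 1 / real (Suc j))" using assms(2) by (simp add: field_simps)
  then have "summable (\<lambda>j. inverse (real j))"
    by (subst summable_Suc_iff[symmetric]) (simp add: inverse_eq_divide)
  then show False using not_summable_harmonic[where 'a = real] by simp
qed

section \<open>Expected merging time\<close>

theorem theorem5p1:
  fixes M :: "'a measure"
    and n Nc :: nat
    and \<epsilon> \<delta>1 \<delta>2 :: real
    and V :: "nat \<Rightarrow> nat set"
    and xs :: "nat \<Rightarrow> real"
    and \<xi> :: "nat \<Rightarrow> 'a \<Rightarrow> real"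
    and x :: "nat \<Rightarrow> 'a \<Rightarrow> nat \<Rightarrow> real"
  assumes "prob_space M"
    and "\<epsilon> > 0"
    and "0 \<le> \<delta>1" and "\<delta>1 \<le> \<delta>2"
    and "0 < \<delta>2" and "\<delta>2 \<le> \<epsilon> / (2 * real n)"
    and "prob_space.indep_vars M (\<lambda>_. borel) \<xi> {1..}"
    and "\<And>t. t \<ge> 1 \<Longrightarrow> distr M borel (\<xi> t) = uniform_measure lborel {-\<delta>1..\<delta>2}"
    and "1 \<in> V 1"
    and "\<And>\<omega>. \<omega> \<in> space M \<Longrightarrow> divisive_state n \<epsilon> Nc V xs (x 0 \<omega>)"
    and "\<And>\<omega>. \<omega> \<in> space M \<Longrightarrow> hk_noisy_path n \<epsilon> (\<lambda>t. \<xi> t \<omega>) (\<lambda>t. x t \<omega>)"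
  shows "(\<delta>1 = \<delta>2 \<longrightarrow>
           (\<integral>\<^sup>+ \<omega>. ennreal_of_enat (merging_time n \<epsilon> (\<lambda>t. x t \<omega>)) \<partial>M) = \<infinity>) \<and>
         (\<delta>1 < \<delta>2 \<longrightarrow>
           (\<integral>\<^sup>+ \<omega>. ennreal_of_enat (merging_time n \<epsilon> (\<lambda>t. x t \<omega>)) \<partial>M)
             \<le> ennreal (2 * real n / (\<delta>2 - \<delta>1) * (xs Nc - xs 1 + (real Nc - 1) * \<delta>2)))"
proof -

  \<comment> \<open>Properties of the noise, and the expectation as a sum of tail
    probabilities\<close>
  interpret prob_space M by fact
  \<comment> \<open>All initial profiles agree on the agents, so the profile of any one outcome can
    serve as \<open>y0\<close>.\<close>
  obtain \<omega>0 where \<omega>0: "\<omega>0 \<in> space M" using not_empty by blast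
  define y0 where "y0 = x 0 \<omega>0"
  have divisive0: "divisive_state n \<epsilon> Nc V xs y0" unfolding y0_def by (intro assms(10) \<omega>0)
  then have n: "2 \<le> n" unfolding divisive_state_def by auto
  interpret hk_clusters n Nc \<epsilon> \<delta>2 V xs y0
  proof
    show "2 * real n * \<delta>2 \<le> \<epsilon>" using assms(6) n by (simp add: field_simps)
  qed (use divisive0 assms in auto)
  note path = assms(11) and init = assms(10)
  have rv: "\<xi> t \<in> borel_measurable M" if "1 \<le> t" for t
    using assms(7) that unfolding indep_vars_def by auto
  have width: "- \<delta>1 < \<delta>2" using assms(3,5) by simp
  have dist: "distributed M lborel (\<xi> t)
      (\<lambda>x. indicator {-\<delta>1..\<delta>2} x / measure lborel {-\<delta>1..\<delta>2})" if "1 \<le> t" for t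
    using that width by (intro uniform_measure_distributed assms(8) rv)
  have bounded: "AE \<omega> in M. \<bar>\<xi> t \<omega>\<bar> \<le> \<delta>2" if "1 \<le> t" for t
    using uniform_distributed_AE_bounds[OF dist[OF that] width]
    by eventually_elim (use assms(4) in auto)
  have AE_noise: "AE \<omega> in M. \<forall>t\<in>{1..}. \<bar>\<xi> t \<omega>\<bar> \<le> \<delta>2"
    using bounded by (subst AE_ball_countable) auto
  have int: "integrable M (\<xi> t)" if "1 \<le> t" for t
    using bounded[OF that] rv[OF that] by (intro integrable_const_bound[of _ \<delta>2]) auto
  have mean: "expectation (\<xi> t) = (\<delta>2 - \<delta>1) / 2" if "1 \<le> t" for t
    using uniform_distributed_expectation[OF dist[OF that]] by simp

  define D where "D t \<omega> \<longleftrightarrow> (\<forall>s\<le>t. \<epsilon> < opinion_diameter n (x s \<omega>))" for t \<omega>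
  define P where "P t = prob {\<omega> \<in> space M. D t \<omega>}" for t
  have state: "x t \<omega> i = hk_state n \<epsilon> y0 (\<lambda>s. \<xi> s \<omega>) t i"
    if "\<omega> \<in> space M" "i \<in> {1..n}" for t \<omega> i
  proof (rule hk_noisy_path_eq_state[OF path[OF that(1)] _ that(2)])
    fix i assume "i \<in> {1..n}"
    then obtain g where "g \<in> {1..Nc}" "i \<in> V g" unfolding V_Union[symmetric] by (rule UN_E)
    then show "x 0 \<omega> i = y0 i"
      using init[OF that(1)] y0_V[of g i] unfolding divisive_state_def by metis
  qed
  have diam: "opinion_diameter n (x t \<omega>) = opinion_diameter n (hk_state n \<epsilon> y0 (\<lambda>s. \<xi> s \<omega>) t)"
    if "\<omega> \<in> space M" for t \<omega>
    using state[OF that] by (rule opinion_diameter_cong)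
  \<comment> \<open>Kept general in \<open>\<zeta>\<close>, as it is applied both to the noise on
    \<open>M\<close> and to the coordinates of the product space of past noise values.\<close>
  have diam_pred: "Measurable.pred N (\<lambda>w. \<forall>s\<le>t. \<epsilon> < opinion_diameter n (hk_state n \<epsilon> y0 (\<zeta> w) s))"
    if "\<And>s. s \<in> {1..t} \<Longrightarrow> (\<lambda>w. \<zeta> w s) \<in> borel_measurable N"
    for N :: "'b measure" and \<zeta> :: "'b \<Rightarrow> nat \<Rightarrow> real" and t
    using n that
    by (intro pred_intros_countable(1) pred_intros_imp'(1) measurable_opinion_diameter_gt measurable_hk_state) auto
  have D_pred [measurable]: "Measurable.pred M (D t)" for t
  proof -
    have pred: "Measurable.pred M
        (\<lambda>\<omega>. \<forall>s\<le>t. \<epsilon> < opinion_diameter n (hk_state n \<epsilon> y0 (\<lambda>s. \<xi> s \<omega>) s))"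
      using rv by (intro diam_pred) auto
    have "Measurable.pred M (D t) \<longleftrightarrow>
        Measurable.pred M (\<lambda>\<omega>. \<forall>s\<le>t. \<epsilon> < opinion_diameter n (hk_state n \<epsilon> y0 (\<lambda>s. \<xi> s \<omega>) s))"
      by (rule measurable_cong) (simp add: D_def diam)
    then show ?thesis using pred by (rule iffD2)
  qed
  \<comment> \<open>The expectation of a time is the sum of its tail probabilities, and
    \<open>D t\<close> is the event that the merging time exceeds \<open>t\<close>.\<close>
  have ET: "(\<integral>\<^sup>+ \<omega>. ennreal_of_enat (merging_time n \<epsilon> (\<lambda>t. x t \<omega>)) \<partial>M) = (\<Sum>t. ennreal (P t))"
  proof -
    have D_iff: "enat t < merging_time n \<epsilon> (\<lambda>t. x t \<omega>) \<longleftrightarrow> D t \<omega>" for t \<omega>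
      unfolding D_def less_merging_time_iff ..
    have "(\<lambda>\<omega>. merging_time n \<epsilon> (\<lambda>t. x t \<omega>)) \<in> measurable M (count_space UNIV)"
      by (rule measurable_enatI) (unfold D_iff, rule D_pred)
    from nn_integral_enat_function[OF this] show ?thesis
      by (simp add: P_def emeasure_eq_measure of_nat_eq_enat D_iff)
  qed

  \<comment> \<open>Centered noise: infinite expectation\<close>
  have part1: "(\<Sum>t. ennreal (P t)) = \<infinity>" if "\<delta>1 = \<delta>2"
  proof -
    define m where "m = card (V 1)"
    \<comment> \<open>A noise sum below \<open>K\<close> puts the mean more than
      \<open>\<delta>2\<close> below the reach of the second cluster. The forced descent
      \<open>t0 * c = m * \<delta>2\<close> cancels the \<open>\<delta>2\<close> in
      \<open>K\<close>, so \<open>u\<close> is \<open>m\<close> times the positive excess of the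
      first gap over \<open>\<epsilon>\<close>.\<close>
    define t0 where "t0 = 2 * m"
    define c where "c = \<delta>2 / 2"
    define K where "K = real m * (xs 2 - \<epsilon> - \<delta>2 - xs 1)"
    define u where "u = K + real t0 * c"
    define p where "p t = prob {\<omega> \<in> space M. low_walk t0 c K (\<lambda>s. \<xi> s \<omega>) t}" for t
    have m: "0 < m" unfolding m_def using card_V_pos[of 1] Nc_ge by simp
    have "u = real m * (xs 2 - \<epsilon> - xs 1)" unfolding u_def K_def t0_def c_def by (simp add: algebra_simps)
    moreover have "xs 1 + \<epsilon> < xs 2" using xs_gap[of 2 1] Nc_ge by simp
    ultimately have u: "0 < u" using m by simp
    have "0 < prob {\<omega> \<in> space M. \<xi> t \<omega> \<le> - c}" if "1 \<le> t" for t
      using uniform_distributed_measure[OF dist[OF that], of "- c"] \<open>\<delta>1 = \<delta>2\<close> assms(5)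
      by (simp add: c_def)
    then have p0: "0 < p t0"
      unfolding p_def using m u by (intro low_walk_start_prob assms(7)) (auto simp: t0_def u_def)
    have decay: "u * (p t0 - p (t0 + j)) \<le> real j * \<delta>2 * p (t0 + j)" for j
      unfolding u_def p_def using int mean bounded \<open>\<delta>1 = \<delta>2\<close>
      by (intro low_walk_prob_decay assms(7)) auto
    \<comment> \<open>On a low walk the first cluster stays out of sight of the second, so the
      merging time has not been reached.\<close>
    have pP: "p (t0 + j) \<le> P (t0 + j)" for j
      unfolding p_def P_def
    proof (intro finite_measure_mono_AE)
      show "AE \<omega> in M. \<omega> \<in> {\<omega> \<in> space M. low_walk t0 c K (\<lambda>s. \<xi> s \<omega>) (t0 + j)}
          \<longrightarrow> \<omega> \<in> {\<omega> \<in> space M. D (t0 + j) \<omega>}"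
        using AE_noise
      proof eventually_elim
        case (elim \<omega>)
        have "\<epsilon> < opinion_diameter n (x s \<omega>)"
          if \<omega>: "\<omega> \<in> space M" and low: "low_walk t0 c K (\<lambda>s. \<xi> s \<omega>) (t0 + j)" and "s \<le> t0 + j" for s
        proof (rule diameter_gt_if_cohesive)
          have "cohesive 1 (x s \<omega>) \<and>
              merged_mean 1 (x s \<omega>) = xs 1 + (\<Sum>r<s. \<xi> (Suc r) \<omega>) / real (card (V 1))"
          proof (rule cohesive_while_walk_low[OF path[OF \<omega>] init[OF \<omega>]])
            show "\<xi> s \<omega> \<le> 0" if "s \<in> {1..t0}" for s
              using low that assms(5) unfolding low_walk_def c_def by force
            show "xs 1 + (\<Sum>r<s. \<xi> (Suc r) \<omega>) / real (card (V 1)) < xs 2 - \<epsilon> - \<delta>2"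
              if "s \<in> {t0..t0 + j}" for s
            proof -
              have "(\<Sum>r<s. \<xi> (Suc r) \<omega>) < K" using low that unfolding low_walk_def by blast
              then have "(\<Sum>r<s. \<xi> (Suc r) \<omega>) / real m < xs 2 - \<epsilon> - \<delta>2 - xs 1"
                using m unfolding K_def by (simp add: pos_divide_less_eq mult.commute)
              then show ?thesis unfolding m_def by simp
            qed
          qed (use elim \<open>s \<le> t0 + j\<close> in auto)
          then show "cohesive 1 (x s \<omega>)" ..
        qed (use Nc_ge in simp)
        then show ?case by (auto simp: D_def)
      qed
    qed simp
    show ?thesis
    \<comment> \<open>The constant comes from
      \<open>u + j * \<delta>2 \<le> (u + \<delta>2) * (j + 1)\<close> in the decay
      estimate.\<close>
    proof (rule suminf_ennreal_eq_top_if_harmonic[of P "u * p t0 / (u + \<delta>2)" t0])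
      show "0 < u * p t0 / (u + \<delta>2)" using u p0 assms(5) by simp
      show "0 \<le> P t" for t by (simp add: P_def)
      show "u * p t0 / (u + \<delta>2) / real (Suc j) \<le> P (t0 + j)" for j
      proof -
        have p: "0 \<le> p (t0 + j)" by (simp add: p_def)
        have "u * p t0 \<le> p (t0 + j) * (u + real j * \<delta>2)"
          using decay[of j] by (simp add: algebra_simps)
        also have "\<dots> \<le> p (t0 + j) * ((u + \<delta>2) * real (Suc j))"
          using u assms(5) by (intro mult_left_mono p) (simp add: algebra_simps)
        finally have "u * p t0 / ((u + \<delta>2) * real (Suc j)) \<le> p (t0 + j)"
          using u assms(5) by (subst pos_divide_le_eq) auto
        then show ?thesis using pP[of j] by simp
      qed
    qed
  qed

  \<comment> \<open>Noise with positive mean: bounded expectation\<close>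
  have part2: "(\<Sum>t. ennreal (P t))
      \<le> ennreal (2 * real n / (\<delta>2 - \<delta>1) * (xs Nc - xs 1 + (real Nc - 1) * \<delta>2))"
    if less: "\<delta>1 < \<delta>2"
  proof -
    define \<mu> where "\<mu> = (\<delta>2 - \<delta>1) / 2"
    have \<mu>: "0 < \<mu>" unfolding \<mu>_def using less by simp
    define f where "f t \<omega> = (if D t \<omega> then hk_weight n \<epsilon> (x t \<omega>) else 0)" for t \<omega>
    have mult: "integrable M (f t)" "integrable M (\<lambda>\<omega>. f t \<omega> * \<xi> (Suc t) \<omega>)"
      "expectation (\<lambda>\<omega>. f t \<omega> * \<xi> (Suc t) \<omega>) = expectation (f t) * \<mu>" for t
    proof -
      \<comment> \<open>\<open>f t\<close> as a function of the past noise, obtained through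
        \<open>hk_state\<close>; the two agree on \<open>space M\<close>.\<close>
      define F where "F w = (if \<forall>s\<le>t. \<epsilon> < opinion_diameter n (hk_state n \<epsilon> y0 w s)
          then hk_weight n \<epsilon> (hk_state n \<epsilon> y0 w t) else 0)" for w
      have eq: "F (\<lambda>s\<in>{1..t}. \<xi> s \<omega>) = f t \<omega>" if "\<omega> \<in> space M" for \<omega>
      proof -
        have s: "hk_state n \<epsilon> y0 (\<lambda>s\<in>{1..t}. \<xi> s \<omega>) s = hk_state n \<epsilon> y0 (\<lambda>s. \<xi> s \<omega>) s"
          if "s \<le> t" for s using that by (intro hk_state_cong) auto
        have "hk_weight n \<epsilon> (x t \<omega>) = hk_weight n \<epsilon> (hk_state n \<epsilon> y0 (\<lambda>s. \<xi> s \<omega>) t)"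
          using state[OF that] n by (intro hk_weight_cong) auto
        then show ?thesis unfolding F_def f_def D_def using s diam[OF that] by auto
      qed
      have weight: "(\<lambda>w. hk_weight n \<epsilon> (hk_state n \<epsilon> y0 w t))
          \<in> borel_measurable (PiM {1..t} (\<lambda>_. borel))"
        by (intro measurable_hk_weight measurable_hk_state measurable_component_singleton)
      have pred: "Measurable.pred (PiM {1..t} (\<lambda>_. borel))
          (\<lambda>w. \<forall>s\<le>t. \<epsilon> < opinion_diameter n (hk_state n \<epsilon> y0 w s))"
        by (intro diam_pred measurable_component_singleton)
      have F: "F \<in> borel_measurable (PiM {1..t} (\<lambda>_. borel))" 
        unfolding F_def by (rule measurable_If[OF weight measurable_const predE[OF pred]]) simp
      have b: "\<bar>F w\<bar> \<le> 1" for w unfolding F_def using hk_weight_bounds by simp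
      note * = expectation_past_mult[OF assms(7) F b int[of "Suc t"]]
      have c1: "integrable M (\<lambda>\<omega>. F (\<lambda>s\<in>{1..t}. \<xi> s \<omega>)) = integrable M (f t)"
        "integrable M (\<lambda>\<omega>. F (\<lambda>s\<in>{1..t}. \<xi> s \<omega>) * \<xi> (Suc t) \<omega>)
          = integrable M (\<lambda>\<omega>. f t \<omega> * \<xi> (Suc t) \<omega>)"
        "expectation (\<lambda>\<omega>. F (\<lambda>s\<in>{1..t}. \<xi> s \<omega>)) = expectation (f t)"
        "expectation (\<lambda>\<omega>. F (\<lambda>s\<in>{1..t}. \<xi> s \<omega>) * \<xi> (Suc t) \<omega>)
          = expectation (\<lambda>\<omega>. f t \<omega> * \<xi> (Suc t) \<omega>)"
        using eq by (auto intro!: Bochner_Integration.integrable_cong Bochner_Integration.integral_cong)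
      show "integrable M (f t)" "integrable M (\<lambda>\<omega>. f t \<omega> * \<xi> (Suc t) \<omega>)"
        "expectation (\<lambda>\<omega>. f t \<omega> * \<xi> (Suc t) \<omega>) = expectation (f t) * \<mu>"
        using *[unfolded c1] mean[of "Suc t"] by (simp_all add: \<mu>_def)
    qed
    \<comment> \<open>Agent 1 has at most \<open>n\<close> neighbors, so its weight is at least
      \<open>1 / n\<close>.\<close>
    have lower: "P t / real n \<le> expectation (f t)" for t
    proof -
      have "P t / real n = expectation (\<lambda>\<omega>. indicator {\<omega> \<in> space M. D t \<omega>} \<omega> / real n)"
        by (simp add: P_def)
      also have "\<dots> \<le> expectation (f t)"
      proof (intro integral_mono mult(1))
        fix \<omega> assume "\<omega> \<in> space M"
        then show "indicator {\<omega> \<in> space M. D t \<omega>} \<omega> / real n \<le> f t \<omega>"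
          unfolding f_def using hk_weight_ge[of n \<epsilon> "x t \<omega>"] n eps_pos
          by (auto split: split_indicator)
      next
        show "integrable M (\<lambda>\<omega>. indicator {\<omega> \<in> space M. D t \<omega>} \<omega> / real n)"
          by (intro integrable_divide integrable_real_indicator) (auto simp: less_top[symmetric])
      qed
      finally show ?thesis .
    qed
    \<comment> \<open>The pathwise bound \<open>stopped_sum_le\<close> in expectation: by
      independence the term at time \<open>t\<close> contributes at least
      \<open>\<mu> * P t / n\<close>.\<close>
    have sum_le: "(\<Sum>t<N. P t) \<le> real n / \<mu> * (xs Nc - xs 1)" for N
    proof -
      have "AE \<omega> in M. (\<Sum>t<N. f t \<omega> * \<xi> (Suc t) \<omega>) \<le> xs Nc - xs 1"
        using AE_noise AE_space
      proof eventually_elim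
        case (elim \<omega>)
        show ?case unfolding f_def D_def
          using elim(1) by (intro stopped_sum_le[OF path[OF elim(2)] init[OF elim(2)]]) auto
      qed
      then have "expectation (\<lambda>\<omega>. \<Sum>t<N. f t \<omega> * \<xi> (Suc t) \<omega>) \<le> expectation (\<lambda>\<omega>. xs Nc - xs 1)"
        using mult by (intro integral_mono_AE) auto
      then have "(\<Sum>t<N. expectation (f t) * \<mu>) \<le> xs Nc - xs 1"
        using mult by (simp add: Bochner_Integration.integral_sum prob_space)
      moreover have "(\<Sum>t<N. P t / real n * \<mu>) \<le> (\<Sum>t<N. expectation (f t) * \<mu>)"
        using lower \<mu> by (intro sum_mono mult_right_mono) auto
      ultimately have "(\<Sum>t<N. P t) / real n * \<mu> \<le> xs Nc - xs 1"
        by (simp add: sum_divide_distrib sum_distrib_right)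
      then show ?thesis using n \<mu> by (simp add: field_simps)
    qed
    have "(\<Sum>t. ennreal (P t)) \<le> ennreal (real n / \<mu> * (xs Nc - xs 1))"
      unfolding suminf_eq_SUP
    proof (rule SUP_least)
      fix N
      have "(\<Sum>t<N. ennreal (P t)) = ennreal (\<Sum>t<N. P t)" by (simp add: P_def sum_ennreal)
      also have "\<dots> \<le> ennreal (real n / \<mu> * (xs Nc - xs 1))" by (intro ennreal_leI sum_le)
      finally show "(\<Sum>t<N. ennreal (P t)) \<le> ennreal (real n / \<mu> * (xs Nc - xs 1))" .
    qed
    \<comment> \<open>The summand \<open>(real Nc - 1) * \<delta>2\<close> is nonnegative.\<close>
    also have "\<dots> \<le> ennreal (real n / \<mu> * (xs Nc - xs 1 + (real Nc - 1) * \<delta>2))"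
      using \<mu> Nc_ge assms(5) by (intro ennreal_leI mult_left_mono) auto
    also have "real n / \<mu> = 2 * real n / (\<delta>2 - \<delta>1)" by (simp add: \<mu>_def)
    finally show ?thesis .
  qed

  show ?thesis using part1 part2 unfolding ET by blast
qed

end
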